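(* Let $$\mathbf W^{\leq1}[\mathrm{LTF}]=\inf\bigl\{\mathbf W^{\leq1}[f]: f\text{ is a Boolean linear threshold function on a finite cube}\bigr\},$$ the infimum being over all $n\ge1$ and all linear threshold functions $f:\{-1,1\}^n\to\{-1,1\}$. Then $$\mathbf W^{\leq1}[\mathrm{LTF}]\geq\left(\frac1{\sqrt2}+\frac{277}{12000}\right)^2>0.53317.$$
   Context: Equip $\{-1,1\}^n$ with the uniform probability measure. For $f:\{-1,1\}^n\to\mathbb R$ and $S\subseteq\{1,\dots,n\}$ let $\widehat f(S)=\mathbb E\left[f(x)\prod_{i\in S}x_i\right]$, and set $\mathbf W^{\le1}[f]=\sum_{|S|\le1}\widehat f(S)^2$. A linear threshold function (LTF) is a function $f:\{-1,1\}^n\to\{-1,1\}$ of the form $f(x)=\operatorname{sgn}(\omega_0+\omega_1x_1+\cdots+\omega_nx_n)$ with real constants $\omega_0,\dots,\omega_n$, where $\operatorname{sgn}(t)=1$ for $t\ge0$ and $\operatorname{sgn}(t)=-1$ for $t<0$. *)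

theory Defs
  imports "HOL-Probability.Probability"
begin

text \<open>Points of the cube are functions on the index set \<open>{1..n}\<close>, extended by \<open>undefined\<close>
  elsewhere, so that each point of the cube has exactly one representative.\<close>

definition cube :: "nat \<Rightarrow> (nat \<Rightarrow> real) set" where
  "cube n = {1..n} \<rightarrow>\<^sub>E {-1, 1}"

definition expect :: "nat \<Rightarrow> ((nat \<Rightarrow> real) \<Rightarrow> real) \<Rightarrow> real" where
  "expect n g = measure_pmf.expectation (pmf_of_set (cube n)) g"

definition fourier_coeff :: "nat \<Rightarrow> ((nat \<Rightarrow> real) \<Rightarrow> real) \<Rightarrow> nat set \<Rightarrow> real" where
  "fourier_coeff n f S = expect n (\<lambda>x. f x * (\<Prod>i\<in>S. x i))"

definition weight_le1 :: "nat \<Rightarrow> ((nat \<Rightarrow> real) \<Rightarrow> real) \<Rightarrow> real" where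
  "weight_le1 n f = (\<Sum>S | S \<subseteq> {1..n} \<and> card S \<le> 1. (fourier_coeff n f S)\<^sup>2)"

text \<open>Unlike the library's \<^const>\<open>sgn\<close>, the sign of \<open>0\<close> is \<open>1\<close> here.\<close>

definition sign_pm :: "real \<Rightarrow> real" where
  "sign_pm t = (if t \<ge> 0 then 1 else -1)"

text \<open>Only the values of \<open>f\<close> on the cube matter, both here and in \<^const>\<open>weight_le1\<close>.\<close>

definition is_LTF :: "nat \<Rightarrow> ((nat \<Rightarrow> real) \<Rightarrow> real) \<Rightarrow> bool" where
  "is_LTF n f \<longleftrightarrow>
    (\<exists>\<omega> :: nat \<Rightarrow> real. \<forall>x\<in>cube n. f x = sign_pm (\<omega> 0 + (\<Sum>i=1..n. \<omega> i * x i)))"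

definition LTF_weights :: "real set" where
  "LTF_weights = {weight_le1 n f | n f. n \<ge> 1 \<and> is_LTF n f}"

definition W_le1_LTF :: real where
  "W_le1_LTF = Inf LTF_weights"

text \<open>The infimum is that of a nonempty set bounded below, hence a genuine one.\<close>

lemma LTF_weights_nonempty: "LTF_weights \<noteq> {}"
proof -
  have "is_LTF 1 (\<lambda>x. 1)"
    unfolding is_LTF_def by (rule exI[of _ "\<lambda>_. 0"]) (simp add: sign_pm_def)
  then show ?thesis
    unfolding LTF_weights_def by blast
qed

lemma LTF_weights_bdd_below: "bdd_below LTF_weights"
  by (rule bdd_belowI[of _ 0]) (auto simp: LTF_weights_def weight_le1_def intro!: sum_nonneg)

end

theory Submission
  imports Defs "HOL-Real_Asymp.Real_Asymp"
begin

text \<open>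
Adding a coordinate \<open>x\<^sub>0\<close> for the threshold turns the weight of a threshold function into
\<open>W = (\<Sum>i. (E F x\<^sub>i)\<^sup>2)\<close> for \<open>F = sgn S\<close> and a linear form \<open>S = (\<Sum>i. w\<^sub>i x\<^sub>i)\<close> with
\<open>(\<Sum>i. w\<^sub>i\<^sup>2) = 1\<close>. Since \<open>(\<Sum>i. w\<^sub>i E F x\<^sub>i) = E F S = E\<bar>S\<bar>\<close>, the Cauchy--Schwarz inequality gives
\<open>W \<ge> (E\<bar>S\<bar>)\<^sup>2\<close>, and \<open>E\<bar>S\<bar> \<ge> 1 / sqrt 2\<close> is the Khintchine inequality with Szarek's constant. A gain
over \<open>1 / sqrt 2\<close> has to deal with its extremal case \<open>w = (1 / sqrt 2, 1 / sqrt 2, 0, \<dots>)\<close>. Let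
\<open>\<tau> = 0.7302\<close>, which is slightly more than \<open>1 / sqrt 2 + 277 / 12000\<close>; the claim is \<open>W \<ge> \<tau>\<^sup>2\<close>.

Let \<open>a \<ge> b\<close> be the two largest weights, \<open>s = a + b\<close>, \<open>d = a - b\<close>, \<open>R\<close> the rest of the form and
\<open>r\<^sup>2 = E R\<^sup>2\<close>. Three estimates together cover all weights.

\<^item> Averaging over the two leading signs and using convexity gives
  \<open>E\<bar>S\<bar> \<ge> (s + max d (E\<bar>R\<bar>)) / 2\<close>, where \<open>E\<bar>R\<bar> \<ge> 0.69 r\<close> (lemmas \<open>khintchine_weak\<close> and
  \<open>avg_abs_lin_pair_ge\<close>). If this is below \<open>\<tau>\<close>, then the identity \<open>s\<^sup>2 + d\<^sup>2 + 2 r\<^sup>2 = 2\<close> forces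
  either \<open>s \<le> 1.0404\<close> or weights very close to the extremal case (lemma \<open>sphere_dichotomy\<close>).

\<^item> If \<open>s \<le> 1.0404\<close>, then \<open>(\<Sum>i. w\<^sub>i\<^sup>4)\<close> is at most \<open>0.33\<close>, and the inequality
  \<open>E\<bar>S\<bar> \<ge> sqrt (2 / pi) * (1 - (\<Sum>i. w\<^sub>i\<^sup>4) / 4)\<close> suffices (lemma \<open>avg_abs_lin_lower_bound\<close>).

\<^item> Close to the extremal case \<open>E\<bar>S\<bar>\<close> may be too small, but the vector of the coefficients \<open>E F x\<^sub>i\<close> then
  is far from parallel to \<open>w\<close>. When \<open>x\<^sub>p = x\<^sub>q\<close> for the two leading indices, these signs decide
  \<open>F\<close>; when \<open>x\<^sub>p = - x\<^sub>q\<close>, the sum \<open>S\<close> is \<open>\<plusminus>d + R\<close>, again a Rademacher sum. The two halves of the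
  cube contribute about \<open>1/2\<close> and at least \<open>0.69\<^sup>2 / 4\<close> to \<open>W\<close> in orthogonal directions (lemma
  \<open>near_extremal_weight\<close>).

The inequality with fourth powers is a form of Haagerup's proof of Szarek's bound. It starts from
\<open>pi \<bar>u\<bar> = \<integral> (1 - cos (t u)) / t\<^sup>2 dt\<close>, so that \<open>pi E\<bar>S\<bar> = \<integral> (1 - (\<Prod>i. cos (t w\<^sub>i))) / t\<^sup>2 dt\<close>. The
weighted inequality of arithmetic and geometric means bounds the product by
\<open>(\<Sum>i. w\<^sub>i\<^sup>2 \<bar>cos (t w\<^sub>i)\<bar> powr (1 / w\<^sub>i\<^sup>2))\<close> and so reduces everything to one function of
\<open>\<sigma> = 1 / w\<^sub>i\<^sup>2\<close>, the integral of \<open>(1 - \<bar>cos u\<bar> powr \<sigma>) / u\<^sup>2\<close>. The identity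
\<open>(\<Sum>k. 1 / (u + k pi)\<^sup>2) = 1 / (sin u)\<^sup>2\<close> folds this integral onto one period, where integration by
parts turns it into \<open>\<sigma>\<close> times the Wallis integral \<open>\<integral> \<bar>cos u\<bar> powr \<sigma>\<close>. The recursion and the
asymptotics of Wallis integrals then yield the explicit bound \<open>wallis_lower_bound\<close>.
\<close>

section \<open>Averages over a cube\<close>

definition signs :: "'i set \<Rightarrow> ('i \<Rightarrow> real) set" where
  "signs I = I \<rightarrow>\<^sub>E {-1, 1}"

definition avg :: "'i set \<Rightarrow> (('i \<Rightarrow> real) \<Rightarrow> real) \<Rightarrow> real" where
  "avg I g = (\<Sum>x\<in>signs I. g x) / 2 ^ card I"

definition lin :: "'i set \<Rightarrow> ('i \<Rightarrow> real) \<Rightarrow> ('i \<Rightarrow> real) \<Rightarrow> real" where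
  "lin I w x = (\<Sum>i\<in>I. w i * x i)"

lemma finite_signs: "finite I \<Longrightarrow> finite (signs I)"
  unfolding signs_def by (rule finite_PiE) auto

lemma card_signs: "finite I \<Longrightarrow> card (signs I) = 2 ^ card I"
  unfolding signs_def by (simp add: card_PiE numeral_2_eq_2)

lemma signs_nth: "x \<in> signs I \<Longrightarrow> i \<in> I \<Longrightarrow> x i = 1 \<or> x i = -1"
  unfolding signs_def by (auto dest: PiE_mem)

lemma avg_cong: "(\<And>x. x \<in> signs I \<Longrightarrow> g x = h x) \<Longrightarrow> avg I g = avg I h"
  unfolding avg_def by simp

lemma avg_mono: "(\<And>x. x \<in> signs I \<Longrightarrow> g x \<le> h x) \<Longrightarrow> avg I g \<le> avg I h"
  unfolding avg_def by (intro divide_right_mono sum_mono) auto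

lemma avg_add: "avg I (\<lambda>x. g x + h x) = avg I g + avg I h"
  unfolding avg_def by (simp add: sum.distrib add_divide_distrib)

lemma avg_diff: "avg I (\<lambda>x. g x - h x) = avg I g - avg I h"
  unfolding avg_def by (simp add: sum_subtractf diff_divide_distrib)

lemma avg_cmult: "avg I (\<lambda>x. c * g x) = c * avg I g"
  unfolding avg_def by (simp add: sum_distrib_left)

lemma avg_const: "finite I \<Longrightarrow> avg I (\<lambda>x. c) = c"
  unfolding avg_def by (simp add: card_signs)

lemma avg_sum: "avg I (\<lambda>x. \<Sum>j\<in>A. g j x) = (\<Sum>j\<in>A. avg I (g j))"
  unfolding avg_def by (subst sum.swap) (simp add: sum_divide_distrib)

lemma avg_nonneg: "(\<And>x. x \<in> signs I \<Longrightarrow> 0 \<le> g x) \<Longrightarrow> 0 \<le> avg I g"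
  unfolding avg_def by (intro divide_nonneg_nonneg sum_nonneg) auto

lemma avg_empty: "avg {} g = g (\<lambda>_. undefined)"
  unfolding avg_def signs_def by simp

lemma avg_insert:
  assumes "finite I" "i \<notin> I"
  shows "avg (insert i I) g = (avg I (\<lambda>x. g (x(i := 1))) + avg I (\<lambda>x. g (x(i := -1)))) / 2"
proof -
  have "(\<Sum>x\<in>signs (insert i I). g x) = (\<Sum>(y, x)\<in>{-1, 1} \<times> signs I. g (x(i := y)))"
    unfolding signs_def PiE_insert_eq
    by (subst sum.reindex) (auto intro!: inj_combinator assms(2) sum.cong)
  also have "\<dots> = (\<Sum>y\<in>{-1, 1}. \<Sum>x\<in>signs I. g (x(i := y)))"
    by (rule sum.cartesian_product[symmetric])
  finally have "(\<Sum>x\<in>signs (insert i I). g x)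
      = (\<Sum>x\<in>signs I. g (x(i := 1))) + (\<Sum>x\<in>signs I. g (x(i := -1)))" by simp
  then show ?thesis using assms by (simp add: avg_def add_divide_distrib)
qed

lemma lin_insert_upd:
  assumes "finite I" "i \<notin> I"
  shows "lin (insert i I) w (x(i := e)) = e * w i + lin I w x"
proof -
  have "(\<Sum>j\<in>I. w j * (x(i := e)) j) = (\<Sum>j\<in>I. w j * x j)"
    using assms(2) by (intro sum.cong) auto
  then show ?thesis using assms unfolding lin_def by simp
qed

lemma avg_lin_insert:
  assumes "finite I" "i \<notin> I"
  shows "avg (insert i I) (\<lambda>x. \<phi> (lin (insert i I) w x))
    = (avg I (\<lambda>x. \<phi> (w i + lin I w x)) + avg I (\<lambda>x. \<phi> (- w i + lin I w x))) / 2"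
  by (simp add: avg_insert[OF assms] lin_insert_upd[OF assms])

text \<open>The characteristic function of a Rademacher sum. The phase \<open>\<theta>\<close> makes the induction go
  through.\<close>

lemma avg_cos_lin:
  assumes "finite I"
  shows "avg I (\<lambda>x. cos (\<theta> + t * lin I w x)) = cos \<theta> * (\<Prod>i\<in>I. cos (t * w i))"
  using assms
proof (induction arbitrary: \<theta>)
  case (insert i I)
  have "avg (insert i I) (\<lambda>x. cos (\<theta> + t * lin (insert i I) w x))
    = (cos (\<theta> + t * w i) + cos (\<theta> - t * w i)) / 2 * (\<Prod>i\<in>I. cos (t * w i))"
    using insert.IH[of "\<theta> + t * w i"] insert.IH[of "\<theta> - t * w i"]
      avg_lin_insert[OF insert.hyps(1,2), of "\<lambda>r. cos (\<theta> + t * r)" w]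
    by (simp add: algebra_simps)
  also have "cos (\<theta> + t * w i) + cos (\<theta> - t * w i) = 2 * (cos \<theta> * cos (t * w i))"
    by (simp add: cos_add cos_diff)
  finally show ?case using insert.hyps by simp
qed (simp add: avg_empty lin_def)

definition flip :: "'i set \<Rightarrow> ('i \<Rightarrow> real) \<Rightarrow> ('i \<Rightarrow> real) \<Rightarrow> 'i \<Rightarrow> real" where
  "flip I e x = (\<lambda>i\<in>I. e i * x i)"

lemma flip_signs:
  assumes "e \<in> I \<rightarrow> {-1, 1}" "x \<in> signs I"
  shows "flip I e x \<in> signs I"
proof -
  have "e i * x i = -1 \<or> e i * x i = 1" if "i \<in> I" for i
    using funcset_mem[OF assms(1) that] signs_nth[OF assms(2) that] by auto
  then show ?thesis unfolding flip_def signs_def by auto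
qed

lemma flip_flip:
  assumes "e \<in> I \<rightarrow> {-1, 1}" "x \<in> signs I"
  shows "flip I e (flip I e x) = x"
proof
  fix i
  show "flip I e (flip I e x) i = x i"
  proof (cases "i \<in> I")
    case True
    then have "e i * (e i * x i) = x i" using funcset_mem[OF assms(1) True] by auto
    then show ?thesis using True by (simp add: flip_def)
  next
    case False
    then have "x i = undefined" using assms(2) unfolding signs_def by (rule PiE_arb[rotated])
    then show ?thesis using False by (simp add: flip_def)
  qed
qed

text \<open>Changing the signs of a fixed set of coordinates preserves the uniform measure. This serves
  twice: to make all weights nonnegative, and to average out the coordinate that carries the
  threshold.\<close>

lemma avg_flip:
  assumes e: "e \<in> I \<rightarrow> {-1, 1}"
  shows "avg I (\<lambda>x. g (flip I e x)) = avg I g"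
proof -
  have "(\<Sum>x\<in>signs I. g (flip I e x)) = (\<Sum>x\<in>signs I. g x)"
    by (rule sum.reindex_bij_witness[of _ "flip I e" "flip I e"])
       (simp_all only: flip_signs[OF e] flip_flip[OF e])
  then show ?thesis by (simp only: avg_def)
qed

lemma lin_flip: "lin I w (flip I e x) = lin I (\<lambda>i. e i * w i) x"
  unfolding lin_def flip_def by (intro sum.cong) auto

section \<open>Folding the measure du / u^2 onto one period\<close>

lemma set_nn_integral_shift:
  fixes g :: "real \<Rightarrow> real"
  assumes [measurable]: "g \<in> borel_measurable borel"
  shows "(\<integral>\<^sup>+u\<in>{a + c..<b + c}. ennreal (g u) \<partial>lborel) = (\<integral>\<^sup>+u\<in>{a..<b}. ennreal (g (u + c)) \<partial>lborel)"
proof -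
  have "(\<integral>\<^sup>+u\<in>{a + c..<b + c}. ennreal (g u) \<partial>lborel)
      = (\<integral>\<^sup>+u. ennreal (g (c + 1 * u)) * indicator {a + c..<b + c} (c + 1 * u) \<partial>lborel)"
    by (subst nn_integral_real_affine[where c = 1 and t = c]) auto
  also have "\<dots> = (\<integral>\<^sup>+u\<in>{a..<b}. ennreal (g (u + c)) \<partial>lborel)"
    by (intro nn_integral_cong) (auto simp: indicator_def add.commute)
  finally show ?thesis .
qed

lemma set_nn_integral_ivl_split:
  fixes g :: "real \<Rightarrow> real"
  assumes [measurable]: "g \<in> borel_measurable borel" and "a \<le> b" "b \<le> c"
  shows "(\<integral>\<^sup>+u\<in>{a..<c}. ennreal (g u) \<partial>lborel)
    = (\<integral>\<^sup>+u\<in>{a..<b}. ennreal (g u) \<partial>lborel) + (\<integral>\<^sup>+u\<in>{b..<c}. ennreal (g u) \<partial>lborel)"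
  using assms(2,3)
  by (subst nn_integral_add[symmetric]) (auto intro!: nn_integral_cong simp: indicator_def)

text \<open>One step of the folding. Iterated \<open>n\<close> times it writes \<open>1 / (sin u)\<^sup>2\<close> as a sum over \<open>2 ^ n\<close>
  translates of \<open>1 / (2 ^ n * sin (u / 2 ^ n))\<^sup>2\<close>, which tends to \<open>1 / u\<^sup>2\<close>. Hence no infinite
  series of translates has to be summed.\<close>

lemma cosec_sq_half_angle:
  fixes u :: real
  assumes "sin u \<noteq> 0"
  shows "1 / (sin u)\<^sup>2 = (1 / (sin (u / 2))\<^sup>2 + 1 / (sin ((u + pi) / 2))\<^sup>2) / 4"
proof -
  define c s where "c = cos (u / 2)" and "s = sin (u / 2)"
  have su: "sin u = 2 * s * c"
    using sin_double[of "u / 2"] by (simp add: c_def s_def)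
  have sc: "sin ((u + pi) / 2) = c"
    by (simp add: c_def add_divide_distrib sin_add)
  have "s\<^sup>2 + c\<^sup>2 = 1" by (simp add: s_def c_def)
  moreover have "s \<noteq> 0" "c \<noteq> 0" using assms su by auto
  ultimately show ?thesis
    unfolding su sc s_def[symmetric]
    by (simp add: field_simps power2_eq_square)
qed

text \<open>These are \<open>sin x \<le> x\<close> and \<open>x \<le> tan x\<close>; the second reads
  \<open>1 / (sin x)\<^sup>2 = 1 + 1 / (tan x)\<^sup>2 \<le> 1 + 1 / x\<^sup>2\<close>.\<close>

lemma cosec_sq_bounds:
  fixes x :: real
  assumes "x \<noteq> 0" "\<bar>x\<bar> \<le> pi / 2"
  shows "1 / x\<^sup>2 \<le> 1 / (sin x)\<^sup>2" "1 / (sin x)\<^sup>2 \<le> 1 / x\<^sup>2 + 1"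
proof -
  define y where "y = \<bar>x\<bar>"
  have y: "0 < y" "y \<le> pi / 2" using assms by (auto simp: y_def)
  have sq: "x\<^sup>2 = y\<^sup>2" "(sin x)\<^sup>2 = (sin y)\<^sup>2" by (auto simp: y_def abs_if)
  have s: "0 < sin y" "sin y \<le> y" using y by (auto intro: sin_gt_zero sin_x_le_x)
  have "(sin y)\<^sup>2 \<le> y\<^sup>2" using s by (intro power_mono) auto
  then show "1 / x\<^sup>2 \<le> 1 / (sin x)\<^sup>2"
    unfolding sq using s y by (intro divide_left_mono) auto
  have "0 * cos 0 - sin 0 \<ge> y * cos y - sin y"
  proof (rule DERIV_nonpos_imp_nonincreasing[of 0 y "\<lambda>y. y * cos y - sin y"])
    show "\<exists>d. ((\<lambda>y. y * cos y - sin y) has_real_derivative d) (at z) \<and> d \<le> 0"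
      if "0 \<le> z" "z \<le> y" for z
      by (rule exI[of _ "- z * sin z"])
         (use that y in \<open>auto intro!: derivative_eq_intros mult_nonneg_nonneg sin_ge_zero\<close>)
  qed (use y in auto)
  moreover have "0 \<le> cos y" using y by (intro cos_ge_zero) auto
  ultimately have "(y * cos y)\<^sup>2 \<le> (sin y)\<^sup>2"
    using y by (intro power_mono) auto
  then have "y\<^sup>2 * (1 - (sin y)\<^sup>2) \<le> (sin y)\<^sup>2"
    by (simp add: power_mult_distrib cos_squared_eq)
  then show "1 / (sin x)\<^sup>2 \<le> 1 / x\<^sup>2 + 1"
    unfolding sq using s y by (simp add: field_simps)
qed

text \<open>An integrand for the measure \<open>du / u\<^sup>2\<close> that is periodic with period \<open>pi\<close>. The condition
  \<open>h_zero\<close> makes the half-angle identity usable also at the multiples of \<open>pi\<close>, where the division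
  by \<open>0\<close> would break it.\<close>

context
  fixes h :: "real \<Rightarrow> real"
  assumes h_meas [measurable]: "h \<in> borel_measurable borel"
    and h_nonneg: "\<And>u. 0 \<le> h u" and h_le_1: "\<And>u. h u \<le> 1"
    and h_periodic: "\<And>u. h (u + pi) = h u"
    and h_zero: "\<And>u. sin u = 0 \<Longrightarrow> h u = 0"
begin

lemma h_periodic_nat: "h (u + real m * pi) = h u"
proof (induction m)
  case (Suc m)
  have "h (u + real (Suc m) * pi) = h ((u + real m * pi) + pi)"
    by (simp add: algebra_simps)
  then show ?case using Suc by (simp only: h_periodic)
qed simp

lemma cosec_sq_unfold:
  "(\<integral>\<^sup>+u\<in>{0..<2 ^ n * pi}. ennreal (h u * (1 / (2 ^ n * sin (u / 2 ^ n))\<^sup>2)) \<partial>lborel)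
    = (\<integral>\<^sup>+u\<in>{0..<pi}. ennreal (h u * (1 / (sin u)\<^sup>2)) \<partial>lborel)"
proof (induction n)
  case (Suc n)
  define p where "p = 2 ^ n * pi"
  define f where "f u = h u * (1 / (2 ^ Suc n * sin (u / 2 ^ Suc n))\<^sup>2)" for u
  have [measurable]: "f \<in> borel_measurable borel" unfolding f_def by measurable
  have f0: "f u \<ge> 0" for u unfolding f_def by (intro mult_nonneg_nonneg h_nonneg) auto
  have p: "p \<ge> 0" by (simp add: p_def)
  have pp: "2 ^ Suc n * pi = p + p" by (simp add: p_def)
  have pt: "f u + f (u + p) = h u * (1 / (2 ^ n * sin (u / 2 ^ n))\<^sup>2)" for u
  proof -
    have hp: "h (u + p) = h u" using h_periodic_nat[of u "2 ^ n"] by (simp add: p_def)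
    show ?thesis
    proof (cases "sin (u / 2 ^ n) = 0")
      case True
      then obtain i :: int where "u / 2 ^ n = of_int i * pi" unfolding sin_zero_iff_int2 by blast
      then have "u = of_int (2 ^ n * i) * pi" by (simp add: field_simps)
      then have "sin u = 0" unfolding sin_zero_iff_int2 by blast
      then have "h u = 0" by (rule h_zero)
      then show ?thesis unfolding f_def hp by simp
    next
      case False
      define v where "v = u / 2 ^ n"
      have e: "u / 2 ^ Suc n = v / 2" "(u + p) / 2 ^ Suc n = (v + pi) / 2"
        by (simp_all add: v_def p_def add_divide_distrib)
      have "H * (1 / (2 ^ Suc n * A)\<^sup>2) + H * (1 / (2 ^ Suc n * B)\<^sup>2)
        = H / (2 ^ n)\<^sup>2 * ((1 / A\<^sup>2 + 1 / B\<^sup>2) / 4)" for H A B :: real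
        by (simp add: power_mult_distrib algebra_simps add_divide_distrib)
      then have "f u + f (u + p) = h u / (2 ^ n)\<^sup>2 *
        ((1 / (sin (v / 2))\<^sup>2 + 1 / (sin ((v + pi) / 2))\<^sup>2) / 4)"
        unfolding f_def e hp .
      also have "\<dots> = h u / (2 ^ n)\<^sup>2 * (1 / (sin v)\<^sup>2)"
        by (simp only: cosec_sq_half_angle[OF False[folded v_def]])
      also have "\<dots> = h u * (1 / (2 ^ n * sin v)\<^sup>2)"
        by (simp add: power_mult_distrib)
      finally show ?thesis unfolding v_def .
    qed
  qed
  have "(\<integral>\<^sup>+u\<in>{0..<2 ^ Suc n * pi}. ennreal (f u) \<partial>lborel)
     = (\<integral>\<^sup>+u\<in>{0..<p}. ennreal (f u) \<partial>lborel) + (\<integral>\<^sup>+u\<in>{0 + p..<p + p}. ennreal (f u) \<partial>lborel)"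
    unfolding pp using p by (subst set_nn_integral_ivl_split[of _ 0 p]) auto
  also have "\<dots> = (\<integral>\<^sup>+u\<in>{0..<p}. ennreal (f u) \<partial>lborel) + (\<integral>\<^sup>+u\<in>{0..<p}. ennreal (f (u + p)) \<partial>lborel)"
    by (subst set_nn_integral_shift) auto
  also have "\<dots> = (\<integral>\<^sup>+u\<in>{0..<p}. ennreal (f u + f (u + p)) \<partial>lborel)"
    by (subst nn_integral_add[symmetric]) (auto intro!: nn_integral_cong simp: indicator_def f0)
  also have "\<dots> = (\<integral>\<^sup>+u\<in>{0..<pi}. ennreal (h u * (1 / (sin u)\<^sup>2)) \<partial>lborel)"
    using Suc unfolding pt unfolding p_def .
  finally show ?case unfolding f_def .
qed simp

text \<open>The same integral over a window that is symmetric about \<open>0\<close>, where \<open>sin (u / 2 ^ Suc n)\<close> can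
  be compared with its argument.\<close>

lemma cosec_sq_window:
  "(\<integral>\<^sup>+u\<in>{- (2 ^ n * pi)..<2 ^ n * pi}. ennreal (h u * (1 / (2 ^ Suc n * sin (u / 2 ^ Suc n))\<^sup>2)) \<partial>lborel)
    = (\<integral>\<^sup>+u\<in>{0..<pi}. ennreal (h u * (1 / (sin u)\<^sup>2)) \<partial>lborel)"
proof -
  define p where "p = 2 ^ n * pi"
  define f where "f u = h u * (1 / (2 ^ Suc n * sin (u / 2 ^ Suc n))\<^sup>2)" for u
  have [measurable]: "f \<in> borel_measurable borel" unfolding f_def by measurable
  have p: "p \<ge> 0" by (simp add: p_def)
  have pp: "2 ^ Suc n * pi = p + p" by (simp add: p_def)
  have per: "f (u + 2 * p) = f u" for u
  proof -
    have "h (u + 2 * p) = h u" using h_periodic_nat[of u "2 ^ Suc n"] by (simp add: p_def mult_ac)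
    moreover have "(u + 2 * p) / 2 ^ Suc n = u / 2 ^ Suc n + pi" by (simp add: p_def field_simps)
    ultimately show ?thesis unfolding f_def by (simp only:) simp
  qed
  have "(\<integral>\<^sup>+u\<in>{- p..<p}. ennreal (f u) \<partial>lborel)
     = (\<integral>\<^sup>+u\<in>{0..<p}. ennreal (f u) \<partial>lborel) + (\<integral>\<^sup>+u\<in>{- p..<0}. ennreal (f (u + 2 * p)) \<partial>lborel)"
    using p by (subst set_nn_integral_ivl_split[of _ "- p" 0]) (auto simp: per add.commute)
  also have "(\<integral>\<^sup>+u\<in>{- p..<0}. ennreal (f (u + 2 * p)) \<partial>lborel)
     = (\<integral>\<^sup>+u\<in>{- p + 2 * p..<0 + 2 * p}. ennreal (f u) \<partial>lborel)"
    by (subst set_nn_integral_shift) auto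
  also have "(\<integral>\<^sup>+u\<in>{0..<p}. ennreal (f u) \<partial>lborel) + \<dots> = (\<integral>\<^sup>+u\<in>{0..<2 ^ Suc n * pi}. ennreal (f u) \<partial>lborel)"
    unfolding pp using p by (subst set_nn_integral_ivl_split[of _ 0 p]) auto
  finally show ?thesis unfolding f_def p_def cosec_sq_unfold .
qed

lemma window_bounds:
  assumes "u \<in> {- (2 ^ n * pi)..<2 ^ n * pi}"
  shows "h u / u\<^sup>2 \<le> h u * (1 / (2 ^ Suc n * sin (u / 2 ^ Suc n))\<^sup>2)"
    and "h u * (1 / (2 ^ Suc n * sin (u / 2 ^ Suc n))\<^sup>2) \<le> h u / u\<^sup>2 + 1 / (2 ^ Suc n)\<^sup>2"
proof -
  define x where "x = u / 2 ^ Suc n"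
  have u: "u = 2 ^ Suc n * x" by (simp add: x_def)
  have "h u / u\<^sup>2 \<le> h u * (1 / (2 ^ Suc n * sin x)\<^sup>2) \<and>
    h u * (1 / (2 ^ Suc n * sin x)\<^sup>2) \<le> h u / u\<^sup>2 + 1 / (2 ^ Suc n)\<^sup>2"
  proof (cases "x = 0")
    case False
    have x: "\<bar>x\<bar> \<le> pi / 2" using assms by (auto simp: x_def field_simps abs_le_iff)
    have e: "h u / u\<^sup>2 = h u / (2 ^ Suc n)\<^sup>2 * (1 / x\<^sup>2)"
      "h u * (1 / (2 ^ Suc n * sin x)\<^sup>2) = h u / (2 ^ Suc n)\<^sup>2 * (1 / (sin x)\<^sup>2)"
      by (simp_all only: u power_mult_distrib) (auto simp: field_simps)
    have "h u / (2 ^ Suc n)\<^sup>2 * (1 / (sin x)\<^sup>2) \<le> h u / (2 ^ Suc n)\<^sup>2 * (1 / x\<^sup>2 + 1)"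
      using cosec_sq_bounds[OF False x] h_nonneg by (intro mult_left_mono) auto
    also have "\<dots> \<le> h u / (2 ^ Suc n)\<^sup>2 * (1 / x\<^sup>2) + 1 / (2 ^ Suc n)\<^sup>2"
      using h_le_1[of u] by (simp add: ring_distribs divide_right_mono)
    finally show ?thesis unfolding e
      using cosec_sq_bounds[OF False x] h_nonneg by (intro conjI mult_left_mono) auto
  qed (simp add: u)
  then show "h u / u\<^sup>2 \<le> h u * (1 / (2 ^ Suc n * sin (u / 2 ^ Suc n))\<^sup>2)"
    and "h u * (1 / (2 ^ Suc n * sin (u / 2 ^ Suc n))\<^sup>2) \<le> h u / u\<^sup>2 + 1 / (2 ^ Suc n)\<^sup>2"
    by (simp_all only: x_def)
qed

text \<open>The kernels of \<open>cosec_sq_window\<close> exceed \<open>1 / u\<^sup>2\<close> by at most \<open>1 / 4 ^ (n + 1)\<close> on a window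
  of length proportional to \<open>2 ^ n\<close>, so the total error tends to \<open>0\<close>.\<close>

theorem nn_integral_over_square_fold:
  "(\<integral>\<^sup>+u. ennreal (h u / u\<^sup>2) \<partial>lborel) = (\<integral>\<^sup>+u\<in>{0..<pi}. ennreal (h u / (sin u)\<^sup>2) \<partial>lborel)"
proof (rule antisym)
  let ?A = "\<lambda>n. {- (2 ^ n * pi)..<2 ^ n * pi}"
  let ?I = "\<integral>\<^sup>+u\<in>{0..<pi}. ennreal (h u / (sin u)\<^sup>2) \<partial>lborel"
  have I: "?I = (\<integral>\<^sup>+u\<in>{0..<pi}. ennreal (h u * (1 / (sin u)\<^sup>2)) \<partial>lborel)" by simp
  have inA: "\<forall>\<^sub>F n in sequentially. u \<in> ?A n" for u
  proof -
    obtain N where N: "\<bar>u\<bar> < 2 ^ N" using real_arch_pow[of 2 "\<bar>u\<bar>"] by auto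
    show ?thesis
    proof (rule eventually_sequentiallyI[of N])
      fix n assume "N \<le> n"
      then have "(2 :: real) ^ N * 1 \<le> 2 ^ n * pi"
        using pi_gt3 by (intro mult_mono power_increasing) auto
      then show "u \<in> ?A n" using N by auto
    qed
  qed
  \<comment> \<open>Fatou's lemma for one direction; the windows exhaust the line.\<close>
  have "(\<integral>\<^sup>+u. ennreal (h u / u\<^sup>2) \<partial>lborel)
      = (\<integral>\<^sup>+u. liminf (\<lambda>n. ennreal (h u / u\<^sup>2) * indicator (?A n) u) \<partial>lborel)"
  proof (intro nn_integral_cong lim_imp_Liminf[symmetric])
    fix u
    have "\<forall>\<^sub>F n in sequentially. ennreal (h u / u\<^sup>2) * indicator (?A n) u = ennreal (h u / u\<^sup>2)"
      using inA[of u] by eventually_elim (simp add: indicator_def)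
    then show "(\<lambda>n. ennreal (h u / u\<^sup>2) * indicator (?A n) u) \<longlonglongrightarrow> ennreal (h u / u\<^sup>2)"
      by (rule tendsto_eventually)
  qed simp
  also have "\<dots> \<le> liminf (\<lambda>n. \<integral>\<^sup>+u\<in>?A n. ennreal (h u / u\<^sup>2) \<partial>lborel)"
    by (rule nn_integral_liminf) simp
  also have "\<dots> \<le> liminf (\<lambda>n. ?I)"
  proof (intro Liminf_mono always_eventually allI)
    fix n
    have "(\<integral>\<^sup>+u\<in>?A n. ennreal (h u / u\<^sup>2) \<partial>lborel) \<le>
      (\<integral>\<^sup>+u\<in>?A n. ennreal (h u * (1 / (2 ^ Suc n * sin (u / 2 ^ Suc n))\<^sup>2)) \<partial>lborel)"
      using window_bounds(1)[of _ n]
      by (intro nn_integral_mono) (auto simp: indicator_def intro!: ennreal_leI)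
    then show "(\<integral>\<^sup>+u\<in>?A n. ennreal (h u / u\<^sup>2) \<partial>lborel) \<le> ?I"
      unfolding cosec_sq_window by simp
  qed
  also have "\<dots> = ?I" by (simp add: Liminf_const)
  finally show "(\<integral>\<^sup>+u. ennreal (h u / u\<^sup>2) \<partial>lborel) \<le> ?I" .
  have bound: "?I \<le> (\<integral>\<^sup>+u. ennreal (h u / u\<^sup>2) \<partial>lborel) + ennreal (pi / 2 * (1 / 2) ^ n)" for n
  proof -
    have "?I \<le> (\<integral>\<^sup>+u\<in>?A n. (ennreal (h u / u\<^sup>2) + ennreal (1 / (2 ^ Suc n)\<^sup>2)) \<partial>lborel)"
      unfolding I cosec_sq_window[of n, symmetric]
    proof (rule nn_integral_mono)
      fix u
      show "ennreal (h u * (1 / (2 ^ Suc n * sin (u / 2 ^ Suc n))\<^sup>2)) * indicator (?A n) u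
        \<le> (ennreal (h u / u\<^sup>2) + ennreal (1 / (2 ^ Suc n)\<^sup>2)) * indicator (?A n) u"
      proof (cases "u \<in> ?A n")
        case True
        have "ennreal (h u / u\<^sup>2) + ennreal (1 / (2 ^ Suc n)\<^sup>2) = ennreal (h u / u\<^sup>2 + 1 / (2 ^ Suc n)\<^sup>2)"
          using h_nonneg[of u] by (intro ennreal_plus[symmetric]) auto
        then show ?thesis
          using True ennreal_leI[OF window_bounds(2)[OF True]] by (simp only: indicator_simps mult_1_right)
      qed simp
    qed
    also have "\<dots> = (\<integral>\<^sup>+u\<in>?A n. ennreal (h u / u\<^sup>2) \<partial>lborel) + (\<integral>\<^sup>+u\<in>?A n. ennreal (1 / (2 ^ Suc n)\<^sup>2) \<partial>lborel)"
      by (subst nn_integral_add[symmetric]) (auto simp: distrib_right intro!: nn_integral_cong)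
    also have "(\<integral>\<^sup>+u\<in>?A n. ennreal (1 / (2 ^ Suc n)\<^sup>2) \<partial>lborel) = ennreal (1 / (2 ^ Suc n)\<^sup>2) * ennreal (2 * (2 ^ n * pi))"
      by (subst nn_integral_cmult_indicator) (auto simp: mult_ac)
    also have "\<dots> = ennreal (pi / 2 * (1 / 2) ^ n)"
      by (subst ennreal_mult'[symmetric]) (auto simp: field_simps power2_eq_square power_divide intro!: arg_cong[of _ _ ennreal])
    also have "(\<integral>\<^sup>+u\<in>?A n. ennreal (h u / u\<^sup>2) \<partial>lborel) \<le> (\<integral>\<^sup>+u. ennreal (h u / u\<^sup>2) \<partial>lborel)"
      by (intro nn_integral_mono) (auto simp: indicator_def)
    finally show ?thesis by (simp add: add_right_mono)
  qed
  show "?I \<le> (\<integral>\<^sup>+u. ennreal (h u / u\<^sup>2) \<partial>lborel)"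
  proof (rule tendsto_lowerbound)
    have "(\<lambda>n. ennreal (pi / 2 * (1 / 2) ^ n)) \<longlonglongrightarrow> ennreal (pi / 2 * 0)"
      by (intro tendsto_ennrealI tendsto_mult tendsto_const LIMSEQ_realpow_zero) auto
    then have "(\<lambda>n. (\<integral>\<^sup>+u. ennreal (h u / u\<^sup>2) \<partial>lborel) + ennreal (pi / 2 * (1 / 2) ^ n))
       \<longlonglongrightarrow> (\<integral>\<^sup>+u. ennreal (h u / u\<^sup>2) \<partial>lborel) + 0"
      by (intro tendsto_add tendsto_const) auto
    then show "(\<lambda>n. (\<integral>\<^sup>+u. ennreal (h u / u\<^sup>2) \<partial>lborel) + ennreal (pi / 2 * (1 / 2) ^ n))
       \<longlonglongrightarrow> (\<integral>\<^sup>+u. ennreal (h u / u\<^sup>2) \<partial>lborel)" by simp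
  qed (use bound in auto)
qed

end

section \<open>Wallis integrals of real order\<close>

text \<open>For even \<open>s\<close> the number \<open>sqrt s / pi * wallis s\<close> is the first absolute moment of a
  normalised sum of \<open>s\<close> random signs; \<open>wallis\<close> interpolates these moments.\<close>

definition wallis :: "real \<Rightarrow> real" where
  "wallis s = integral {0..pi} (\<lambda>u. \<bar>cos u\<bar> powr s)"

lemma continuous_abs_cos_powr:
  "0 < s \<Longrightarrow> continuous_on A (\<lambda>u::real. \<bar>cos u\<bar> powr s)"
  by (intro continuous_on_powr' continuous_intros) auto

lemma has_integral_wallis:
  assumes "0 < s"
  shows "((\<lambda>u. \<bar>cos u\<bar> powr s) has_integral wallis s) {0..pi}"
  unfolding wallis_def
  by (intro integrable_integral integrable_continuous_interval continuous_abs_cos_powr assms)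

text \<open>Bernoulli's inequality, in the form that controls \<open>(1 - \<bar>cos u\<bar> powr s) / sin u\<close> near the
  zeros of the sine.\<close>

lemma one_minus_abs_cos_powr_le:
  assumes "1 \<le> s"
  shows "1 - \<bar>cos u\<bar> powr s \<le> s * (sin (u::real))\<^sup>2"
proof -
  define c where "c = \<bar>cos u\<bar>"
  have c: "0 \<le> c" "c \<le> 1" by (auto simp: c_def abs_le_iff)
  have "1 - c powr s \<le> s * (1 - c)"
  proof (cases "c = 0")
    case False
    then have c0: "0 < c" using c by simp
    have "- ln c \<le> 1 / c - 1"
      using ln_le_minus_one[of "1 / c"] c0 by (simp add: ln_div)
    then have "1 - (s - 1) * (1 / c - 1) \<le> 1 + (s - 1) * ln c"
      using mult_left_mono[of "- ln c" "1 / c - 1" "s - 1"] assms by simp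
    also have "\<dots> \<le> exp ((s - 1) * ln c)" by (rule exp_ge_add_one_self)
    also have "\<dots> = c powr s / c" using c0 by (simp add: powr_def exp_diff left_diff_distrib)
    finally have "(1 - (s - 1) * (1 / c - 1)) * c \<le> c powr s"
      using c0 by (simp only: le_divide_eq if_True)
    moreover have "(1 - (s - 1) * (1 / c - 1)) * c = 1 - s * (1 - c)"
      using c0 by (simp add: field_simps)
    ultimately show ?thesis by simp
  qed (use assms in auto)
  also have "\<dots> \<le> s * ((1 - c) * (1 + c))"
    using c assms by (intro mult_left_mono) (auto simp: algebra_simps mult_left_le)
  also have "(1 - c) * (1 + c) = (sin u)\<^sup>2"
    by (simp add: c_def sin_squared_eq algebra_simps flip: power2_eq_square)
  finally show ?thesis by (simp add: c_def)
qed

text \<open>Integration by parts with the antiderivative \<open>- cos u / sin u\<close> of \<open>1 / (sin u)\<^sup>2\<close>. The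
  boundary terms vanish because \<open>1 - \<bar>cos u\<bar> powr s\<close> is of order \<open>(sin u)\<^sup>2\<close>.\<close>

lemma has_integral_cosec_sq_one_minus_cos_powr:
  assumes s: "1 \<le> s"
  shows "((\<lambda>u. (1 - \<bar>cos u\<bar> powr s) / (sin u)\<^sup>2) has_integral s * wallis s) {0..pi}"
proof -
  define G where "G u = - (cos u * (1 - \<bar>cos u\<bar> powr s) / sin u)" for u :: real
  have bound: "\<bar>G u\<bar> \<le> s * \<bar>sin u\<bar>" for u
  proof -
    have "\<bar>cos u\<bar> powr s \<le> 1" using s by (intro powr_le1) auto
    then have "\<bar>cos u\<bar> * \<bar>1 - \<bar>cos u\<bar> powr s\<bar> \<le> 1 * (s * \<bar>sin u\<bar>\<^sup>2)"
      using one_minus_abs_cos_powr_le[OF s, of u] s by (intro mult_mono) auto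
    then have "\<bar>cos u\<bar> * \<bar>1 - \<bar>cos u\<bar> powr s\<bar> / \<bar>sin u\<bar> \<le> s * \<bar>sin u\<bar>"
      by (cases "sin u = 0") (simp_all add: divide_le_eq power2_eq_square mult_ac)
    then show ?thesis by (simp add: G_def abs_mult)
  qed
  have cont: "isCont G u" for u
  proof (cases "sin u = 0")
    case True
    have "((\<lambda>x. s * \<bar>sin x\<bar>) \<longlongrightarrow> s * \<bar>sin u\<bar>) (at u)" by (intro tendsto_intros)
    then have lim: "((\<lambda>x. s * \<bar>sin x\<bar>) \<longlongrightarrow> 0) (at u)" using True by simp
    have "(G \<longlongrightarrow> 0) (at u)"
      by (rule Lim_null_comparison[OF always_eventually lim]) (use bound in simp)
    moreover have "G u = 0" using True by (simp add: G_def)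
    ultimately show ?thesis by (simp add: isCont_def)
  next
    case False
    have "isCont (\<lambda>u::real. \<bar>cos u\<bar> powr s) u"
      using continuous_abs_cos_powr[of s UNIV] s by (simp add: continuous_on_eq_continuous_at)
    moreover have "isCont (\<lambda>u. - (cos u * (1 - P u) / sin u)) u" if "isCont P u" for P :: "real \<Rightarrow> real"
      using that False by (intro continuous_intros) auto
    ultimately show ?thesis unfolding G_def by blast
  qed
  have der: "(G has_vector_derivative ((1 - \<bar>cos u\<bar> powr s) / (sin u)\<^sup>2 - s * \<bar>cos u\<bar> powr s)) (at u)"
    if "u \<in> {0<..<pi} - {pi / 2}" for u
  proof -
    have sn: "sin u > 0" using that by (intro sin_gt_zero) auto
    have cs: "cos u \<noteq> 0"
    proof
      assume "cos u = 0"
      then have "cos u = cos (pi / 2)" by simp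
      then have "u = pi / 2" using that cos_inj_pi[of u "pi / 2"] by auto
      then show False using that by simp
    qed
    have e: "\<bar>cos u\<bar> powr (s - 1) * \<bar>cos u\<bar> = \<bar>cos u\<bar> powr s"
      using cs by (simp add: powr_diff)
    define D where "D = - ((((- sin u) * (1 - \<bar>cos u\<bar> powr s)
       + cos u * (- (s * \<bar>cos u\<bar> powr (s - 1) * (sgn (cos u) * (- sin u))))) * sin u
       - cos u * (1 - \<bar>cos u\<bar> powr s) * cos u) / (sin u)\<^sup>2)"
    have "((\<lambda>v. \<bar>cos v\<bar> powr s) has_real_derivative s * \<bar>cos u\<bar> powr (s - 1) * (sgn (cos u) * (- sin u))) (at u)"
    proof -
      have "(abs has_real_derivative sgn (cos u)) (at (cos u))"
      proof (cases "0 < cos u")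
        case True
        show ?thesis
          by (rule has_field_derivative_transform_within_open[of "\<lambda>x. x" _ _ "{0<..}"])
             (use True in \<open>auto intro!: derivative_eq_intros\<close>)
      next
        case False
        show ?thesis
          by (rule has_field_derivative_transform_within_open[of "\<lambda>x. - x" _ _ "{..<0}"])
             (use False cs in \<open>auto intro!: derivative_eq_intros\<close>)
      qed
      then have "((\<lambda>v. \<bar>cos v\<bar>) has_real_derivative sgn (cos u) * (- sin u)) (at u)"
        by (rule DERIV_chain2) (rule DERIV_cos)
      then show ?thesis using cs by (auto intro!: derivative_eq_intros)
    qed
    moreover have "((\<lambda>v. - (cos v * (1 - P v) / sin v)) has_real_derivative
      - ((((- sin u) * (1 - P u) + cos u * (- d)) * sin u - cos u * (1 - P u) * cos u) / (sin u)\<^sup>2)) (at u)"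
      if "(P has_real_derivative d) (at u)" for P d
      using sn that by (auto intro!: derivative_eq_intros simp: power2_eq_square)
    ultimately have "(G has_real_derivative D) (at u)"
      unfolding G_def D_def by blast
    moreover have "D = (1 - \<bar>cos u\<bar> powr s) / (sin u)\<^sup>2 - s * \<bar>cos u\<bar> powr s"
    proof -
      have c: "cos u * sgn (cos u) = \<bar>cos u\<bar>" by (simp add: abs_sgn)
      have "D = ((1 - \<bar>cos u\<bar> powr s) * ((sin u)\<^sup>2 + (cos u)\<^sup>2)
          - s * (\<bar>cos u\<bar> powr (s - 1) * (cos u * sgn (cos u))) * (sin u)\<^sup>2) / (sin u)\<^sup>2"
      proof -
        have "- (((- a) * (1 - p) + c * (- (s * q * (g * (- a))))) * a - c * (1 - p) * c)
          = (1 - p) * (a\<^sup>2 + c\<^sup>2) - s * (q * (c * g)) * a\<^sup>2" for a c p q g :: real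
          by (simp add: power2_eq_square algebra_simps)
        then show ?thesis unfolding D_def minus_divide_left by (rule arg_cong)
      qed
      also have "\<dots> = (1 - \<bar>cos u\<bar> powr s) / (sin u)\<^sup>2 - s * \<bar>cos u\<bar> powr s"
        unfolding c e using sn by (simp add: diff_divide_distrib)
      finally show ?thesis .
    qed
    ultimately show ?thesis by (simp add: has_real_derivative_iff_has_vector_derivative)
  qed
  have "((\<lambda>u. (1 - \<bar>cos u\<bar> powr s) / (sin u)\<^sup>2 - s * \<bar>cos u\<bar> powr s) has_integral (G pi - G 0)) {0..pi}"
    by (rule fundamental_theorem_of_calculus_interior_strong[of "{pi / 2}"])
       (use der cont in \<open>auto intro!: continuous_at_imp_continuous_on\<close>)
  then have "((\<lambda>u. (1 - \<bar>cos u\<bar> powr s) / (sin u)\<^sup>2 - s * \<bar>cos u\<bar> powr s + s * \<bar>cos u\<bar> powr s)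
      has_integral (G pi - G 0) + s * wallis s) {0..pi}"
    by (intro has_integral_add has_integral_mult_right has_integral_wallis) (use s in auto)
  then show ?thesis by (simp add: G_def)
qed

lemma wallis_nonneg: "0 \<le> wallis s"
  unfolding wallis_def
  by (cases "(\<lambda>u. \<bar>cos u\<bar> powr s) integrable_on {0..pi}")
     (auto intro: integral_nonneg simp: not_integrable_integral)

lemma wallis_antimono:
  assumes "0 < s" "s \<le> t"
  shows "wallis t \<le> wallis s"
proof (rule has_integral_le[OF has_integral_wallis has_integral_wallis])
  show "\<bar>cos u\<bar> powr t \<le> \<bar>cos u\<bar> powr s" for u :: real
  proof (cases "cos u = 0")
    case False
    then show ?thesis using assms powr_mono'[of s t "\<bar>cos u\<bar>"] by (simp add: abs_le_iff)
  qed simp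
qed (use assms in auto)

text \<open>The difference of the integrands of \<open>has_integral_cosec_sq_one_minus_cos_powr\<close> for \<open>s + 2\<close>
  and \<open>s\<close> is \<open>\<bar>cos u\<bar> powr s\<close>.\<close>

lemma wallis_rec:
  assumes "1 \<le> s"
  shows "(s + 2) * wallis (s + 2) = (s + 1) * wallis s"
proof -
  have *: "((\<lambda>u. (1 - \<bar>cos u\<bar> powr (s + 2)) / (sin u)\<^sup>2 - (1 - \<bar>cos u\<bar> powr s) / (sin u)\<^sup>2)
     has_integral (s + 2) * wallis (s + 2) - s * wallis s) {0..pi}"
    by (intro has_integral_diff has_integral_cosec_sq_one_minus_cos_powr) (use assms in auto)
  have "((\<lambda>u. \<bar>cos u\<bar> powr s) has_integral (s + 2) * wallis (s + 2) - s * wallis s) {0..pi}"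
  proof (rule has_integral_spike_finite[OF _ _ *])
    show "\<bar>cos u\<bar> powr s = (1 - \<bar>cos u\<bar> powr (s + 2)) / (sin u)\<^sup>2 - (1 - \<bar>cos u\<bar> powr s) / (sin u)\<^sup>2"
      if "u \<in> {0..pi} - {0, pi}" for u
    proof -
      have "sin u > 0" using that by (intro sin_gt_zero) auto
      moreover have e: "\<bar>cos u\<bar> powr (s + 2) = \<bar>cos u\<bar> powr s * (1 - (sin u)\<^sup>2)"
        by (simp add: powr_add cos_squared_eq[symmetric])
      ultimately show ?thesis
        unfolding e diff_divide_distrib[symmetric] by (simp add: algebra_simps)
    qed
  qed auto
  then have "(s + 2) * wallis (s + 2) - s * wallis s = wallis s"
    using has_integral_wallis[of s] assms has_integral_unique by auto
  then show ?thesis by (simp add: algebra_simps)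
qed

lemma wallis_1: "wallis 1 = 2"
proof -
  have "((\<lambda>u. cos u) has_integral (sin (pi / 2) - sin 0)) {0..pi / 2}"
    by (rule fundamental_theorem_of_calculus)
       (auto intro!: derivative_eq_intros simp flip: has_real_derivative_iff_has_vector_derivative)
  then have 1: "((\<lambda>u. \<bar>cos u\<bar> powr 1) has_integral 1) {0..pi / 2}"
    by (subst has_integral_cong[where g = cos]) (auto simp: cos_ge_zero)
  have "((\<lambda>u. - cos u) has_integral ((- sin pi) - (- sin (pi / 2)))) {pi / 2..pi}"
    by (rule fundamental_theorem_of_calculus)
       (auto intro!: derivative_eq_intros simp flip: has_real_derivative_iff_has_vector_derivative)
  moreover have "cos u \<le> 0" if "u \<in> {pi / 2..pi}" for u
    using that cos_ge_zero[of "pi - u"] by (simp add: cos_diff)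
  ultimately have 2: "((\<lambda>u. \<bar>cos u\<bar> powr 1) has_integral 1) {pi / 2..pi}"
    by (subst has_integral_cong[where g = "\<lambda>u. - cos u"]) auto
  have "((\<lambda>u. \<bar>cos u\<bar> powr 1) has_integral 1 + 1) {0..pi}"
    by (rule has_integral_combine[OF _ _ 1 2]) auto
  from has_integral_unique[OF has_integral_wallis this] show ?thesis by simp
qed

lemma wallis_2: "wallis 2 = pi / 2"
proof -
  have *: "((\<lambda>u. (1 - \<bar>cos u\<bar> powr 2) / (sin u)\<^sup>2) has_integral 2 * wallis 2) {0..pi}"
    by (rule has_integral_cosec_sq_one_minus_cos_powr) simp
  have "((\<lambda>u. 1) has_integral 2 * wallis 2) {0..pi}"
  proof (rule has_integral_spike_finite[OF _ _ *])
    show "1 = (1 - \<bar>cos u\<bar> powr 2) / (sin u)\<^sup>2" if "u \<in> {0..pi} - {0, pi}" for u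
    proof -
      have "sin u > 0" using that by (intro sin_gt_zero) auto
      then show ?thesis by (simp add: sin_squared_eq[symmetric])
    qed
  qed auto
  moreover have "((\<lambda>u. 1) has_integral pi) {0..pi}"
    using has_integral_const_real[of "1 :: real" 0 pi] by simp
  from has_integral_unique[OF calculation this] show ?thesis by simp
qed

text \<open>By the recursion the left-hand side does not depend on \<open>n\<close>. This is where \<open>pi\<close> enters the
  asymptotics.\<close>

lemma wallis_product: "real (n + 2) * wallis (real (n + 1)) * wallis (real (n + 2)) = 2 * pi"
proof (induction n)
  case (Suc n)
  have r: "real (Suc n + 2) * wallis (real (Suc n + 2)) = (real n + 2) * wallis (real (n + 1))"
    using wallis_rec[of "real (n + 1)"] by (simp add: add_ac)
  have "real (Suc n + 2) * wallis (real (Suc n + 1)) * wallis (real (Suc n + 2))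
    = wallis (real (Suc n + 1)) * (real (Suc n + 2) * wallis (real (Suc n + 2)))"
    by (simp only: mult_ac)
  also have "\<dots> = real (n + 2) * wallis (real (n + 1)) * wallis (real (n + 2))"
    unfolding r by simp
  finally show ?case unfolding Suc.IH .
qed (simp add: wallis_1 wallis_2)

text \<open>Monotonicity transfers the product formula from integers to a real order. The bound is only
  needed asymptotically, so rounding \<open>s\<close> to an integer does no harm.\<close>

lemma wallis_ge_crude:
  assumes "1 \<le> s"
  shows "sqrt (2 * pi / (s + 3)) \<le> wallis s"
proof -
  define m where "m = nat \<lceil>s\<rceil> - 1"
  have m: "s \<le> real (m + 1)" "real (m + 1) \<le> s + 1"
    using assms unfolding m_def by linarith+
  have W: "wallis (real (m + 2)) \<le> wallis (real (m + 1))" by (rule wallis_antimono) auto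
  have "2 * pi = real (m + 2) * wallis (real (m + 1)) * wallis (real (m + 2))"
    by (rule wallis_product[symmetric])
  also have "\<dots> \<le> (s + 3) * wallis s * wallis s"
    using m assms W wallis_antimono[of s "real (m + 1)"]
    by (intro mult_mono) (auto intro!: mult_nonneg_nonneg wallis_nonneg)
  finally have "2 * pi / (s + 3) \<le> (wallis s)\<^sup>2"
    using assms by (simp add: field_simps power2_eq_square)
  then show ?thesis using wallis_nonneg[of s] by (rule real_le_lsqrt[rotated])
qed

text \<open>The quotient of both sides decreases along \<open>s, s + 2, s + 4, \<dots>\<close> by the recursion, and its
  limit is at least \<open>1\<close> by the crude bound. The correction \<open>1 - 1 / (4 s)\<close> is the best of this
  form: it is the start of the asymptotic expansion.\<close>

theorem wallis_lower_bound:
  assumes s: "1 \<le> s"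
  shows "sqrt (2 * pi / s) * (1 - 1 / (4 * s)) \<le> wallis s"
proof -
  define Q where "Q s = wallis s * sqrt s / (1 - 1 / (4 * s))" for s
  have step: "Q (x + 2) \<le> Q x" if x: "1 \<le> x" for x
  proof -
    have "wallis (x + 2) = (x + 1) / (x + 2) * wallis x"
      using wallis_rec[OF x] x by (simp add: field_simps)
    then have Q2: "Q (x + 2) = wallis x * ((x + 1) / (x + 2) * sqrt (x + 2) / (1 - 1 / (4 * (x + 2))))"
      by (simp add: Q_def)
    have "(x + 1) / (x + 2) * sqrt (x + 2) / (1 - 1 / (4 * (x + 2))) \<le> sqrt x / (1 - 1 / (4 * x))"
    proof (rule power2_le_imp_le)
      have d: "1 - 1 / (4 * (x + 2)) = (4 * x + 7) / (4 * (x + 2))" "1 - 1 / (4 * x) = (4 * x - 1) / (4 * x)"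
        using x by (simp_all add: field_simps)
      have "((x + 1) / (x + 2) * sqrt (x + 2) / (1 - 1 / (4 * (x + 2))))\<^sup>2
          = (x + 1)\<^sup>2 / (x + 2)\<^sup>2 * (x + 2) * ((4 * (x + 2))\<^sup>2 / (4 * x + 7)\<^sup>2)"
        unfolding d power_mult_distrib power_divide using x by simp
      also have "\<dots> = 16 * (x + 1)\<^sup>2 * (x + 2) / (4 * x + 7)\<^sup>2"
      proof -
        have "A / B\<^sup>2 * B * ((4 * B)\<^sup>2 / C) = 16 * A * B / C" if "B \<noteq> 0" for A B C :: real
          using that by (simp add: power2_eq_square)
        note h = this
        show ?thesis by (rule h) (use x in simp)
      qed
      finally have "((x + 1) / (x + 2) * sqrt (x + 2) / (1 - 1 / (4 * (x + 2))))\<^sup>2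
          = 16 * (x + 1)\<^sup>2 * (x + 2) / (4 * x + 7)\<^sup>2" .
      moreover have "(sqrt x / (1 - 1 / (4 * x)))\<^sup>2 = 16 * x ^ 3 / (4 * x - 1)\<^sup>2"
        unfolding d power_divide using x by (simp add: power_mult_distrib power2_eq_square power3_eq_cube)
      moreover have "16 * (x + 1)\<^sup>2 * (x + 2) / (4 * x + 7)\<^sup>2 \<le> 16 * x ^ 3 / (4 * x - 1)\<^sup>2"
      proof -
        \<comment> \<open>both products are quintic with the same coefficients of \<open>x ^ 5\<close>, \<open>x ^ 4\<close> and \<open>x ^ 3\<close>;
          the constant \<open>1 / 4\<close> is chosen for this\<close>
        have "x ^ 3 * (4 * x + 7)\<^sup>2 - (x + 1)\<^sup>2 * (x + 2) * (4 * x - 1)\<^sup>2 = 4 * x\<^sup>2 + 11 * x - 2"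
          by (simp add: power2_eq_square power3_eq_cube algebra_simps)
        moreover have "0 \<le> 4 * x\<^sup>2 + 11 * x - 2" using x zero_le_power2[of x] by linarith
        ultimately have "(x + 1)\<^sup>2 * (x + 2) * (4 * x - 1)\<^sup>2 \<le> x ^ 3 * (4 * x + 7)\<^sup>2" by linarith
        moreover have "16 * A / B \<le> 16 * C / D" if "A * D \<le> C * B" "0 < B" "0 < D" for A B C D :: real
          using that by (simp add: field_simps)
        ultimately have "16 * ((x + 1)\<^sup>2 * (x + 2)) / (4 * x + 7)\<^sup>2 \<le> 16 * x ^ 3 / (4 * x - 1)\<^sup>2"
          using x by simp
        then show ?thesis by (simp add: mult.assoc)
      qed
      ultimately show "((x + 1) / (x + 2) * sqrt (x + 2) / (1 - 1 / (4 * (x + 2))))\<^sup>2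
        \<le> (sqrt x / (1 - 1 / (4 * x)))\<^sup>2" by simp
      show "0 \<le> sqrt x / (1 - 1 / (4 * x))" unfolding d using x by simp
    qed
    from mult_left_mono[OF this wallis_nonneg[of x]] show ?thesis unfolding Q2 by (simp add: Q_def)
  qed
  have "Q (s + 2 * real n) \<le> Q s" for n
  proof (induction n)
    case (Suc n)
    have "Q (s + 2 * real (Suc n)) \<le> Q (s + 2 * real n)"
      using step[of "s + 2 * real n"] s by (simp add: algebra_simps)
    then show ?case using Suc by simp
  qed simp
  moreover have "sqrt (2 * pi * ((s + 2 * real n) / (s + 2 * real n + 3))) \<le> Q (s + 2 * real n)" for n
  proof -
    define x where "x = s + 2 * real n"
    have x: "x \<ge> 1" using s by (simp add: x_def)
    have "sqrt (2 * pi * (x / (x + 3))) = sqrt (2 * pi / (x + 3)) * sqrt x"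
      by (simp add: real_sqrt_mult[symmetric])
    also have "\<dots> \<le> wallis x * sqrt x"
      using wallis_ge_crude[OF x] x by (intro mult_right_mono) auto
    also have "\<dots> = wallis x * sqrt x / 1" by simp
    also have "\<dots> \<le> Q x"
      unfolding Q_def using x wallis_nonneg[of x] by (intro divide_left_mono) (auto simp: field_simps)
    finally show ?thesis unfolding x_def .
  qed
  ultimately have le: "sqrt (2 * pi * ((s + 2 * real n) / (s + 2 * real n + 3))) \<le> Q s" for n
    using order_trans by blast
  have "(\<lambda>n. (s + 2 * real n) / (s + 2 * real n + 3)) \<longlonglongrightarrow> 1"
    by real_asymp
  then have "(\<lambda>n. sqrt (2 * pi * ((s + 2 * real n) / (s + 2 * real n + 3)))) \<longlonglongrightarrow> sqrt (2 * pi * 1)"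
    by (intro tendsto_intros)
  then have "sqrt (2 * pi * 1) \<le> Q s"
    by (rule tendsto_upperbound) (use le in auto)
  moreover have "0 < 1 - 1 / (4 * s)" using s by (simp add: field_simps)
  ultimately have "sqrt (2 * pi) * (1 - 1 / (4 * s)) \<le> wallis s * sqrt s"
    by (simp add: Q_def le_divide_eq)
  then have "sqrt (2 * pi) * (1 - 1 / (4 * s)) / sqrt s \<le> wallis s"
    using s by (simp only: divide_le_eq real_sqrt_gt_0_iff) auto
  then show ?thesis by (simp add: real_sqrt_divide)
qed

section \<open>A lower bound for the first moment of a Rademacher sum\<close>

lemma weighted_arith_geom_mean:
  fixes p y :: "'i \<Rightarrow> real"
  assumes "finite I" "\<And>i. i \<in> I \<Longrightarrow> 0 \<le> p i" "sum p I = 1" "\<And>i. i \<in> I \<Longrightarrow> 0 \<le> y i"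
  shows "(\<Prod>i\<in>I. y i powr p i) \<le> (\<Sum>i\<in>I. p i * y i)"
proof (cases "\<exists>i\<in>I. y i = 0")
  case True
  then have "(\<Prod>i\<in>I. y i powr p i) = 0" using assms(1) by auto
  moreover have "0 \<le> (\<Sum>i\<in>I. p i * y i)" using assms by (intro sum_nonneg) simp
  ultimately show ?thesis by linarith
next
  case False
  then have pos: "0 < y i" if "i \<in> I" for i using assms(4) that by (force simp: less_le)
  have "I \<noteq> {}" using assms(3) by auto
  have "(\<Prod>i\<in>I. y i powr p i) = exp (\<Sum>i\<in>I. p i * ln (y i))"
    unfolding exp_sum[OF assms(1)] using pos
    by (intro prod.cong refl) (metis less_irrefl powr_def)
  also have "\<dots> \<le> (\<Sum>i\<in>I. p i * exp (ln (y i)))"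
    using convex_on_sum[OF assms(1) \<open>I \<noteq> {}\<close> exp_convex assms(3), of "\<lambda>i. ln (y i)"] assms(2) by simp
  also have "\<dots> = (\<Sum>i\<in>I. p i * y i)" using pos by (intro sum.cong) auto
  finally show ?thesis .
qed

lemma nn_integral_one_minus_abs_cos_powr:
  assumes s: "1 \<le> s" and a: "0 \<le> a"
  shows "(\<integral>\<^sup>+t. ennreal ((1 - \<bar>cos (a * t)\<bar> powr s) / t\<^sup>2) \<partial>lborel) = ennreal (a * (s * wallis s))"
proof -
  define h where "h u = 1 - \<bar>cos u\<bar> powr s" for u :: real
  have hm [measurable]: "h \<in> borel_measurable borel" unfolding h_def by measurable
  have le1: "\<bar>cos u\<bar> powr s \<le> 1" for u :: real using s by (intro powr_le1) auto
  have "(\<integral>\<^sup>+u. ennreal (h u / u\<^sup>2) \<partial>lborel) = (\<integral>\<^sup>+u\<in>{0..<pi}. ennreal (h u / (sin u)\<^sup>2) \<partial>lborel)"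
  proof (rule nn_integral_over_square_fold)
    fix u :: real
    show "h u = 0" if "sin u = 0"
    proof -
      have "(cos u)\<^sup>2 = 1" using that by (simp add: cos_squared_eq)
      then have "\<bar>cos u\<bar> = 1" by (auto simp: power2_eq_1_iff)
      then show ?thesis by (simp add: h_def)
    qed
  qed (use le1 in \<open>auto simp: h_def\<close>)
  also have "\<dots> = (\<integral>\<^sup>+u. ennreal (h u / (sin u)\<^sup>2) * indicator {0..pi} u \<partial>lborel)"
    by (intro nn_integral_cong) (auto simp: indicator_def)
  also have "\<dots> = ennreal (s * wallis s)"
    using has_integral_cosec_sq_one_minus_cos_powr[OF s] le1
    by (intro nn_integral_has_integral_lebesgue') (auto simp: h_def)
  finally have 1: "(\<integral>\<^sup>+u. ennreal (h u / u\<^sup>2) \<partial>lborel) = ennreal (s * wallis s)" .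
  show ?thesis
  proof (cases "a = 0")
    case False
    then have "a > 0" using a by simp
    have "(\<integral>\<^sup>+t. ennreal (h (a * t) / t\<^sup>2) \<partial>lborel) = (\<integral>\<^sup>+t. ennreal a * (ennreal a * ennreal (h (0 + a * t) / (0 + a * t)\<^sup>2)) \<partial>lborel)"
      using \<open>a > 0\<close>
      by (intro nn_integral_cong) (simp add: ennreal_mult'[symmetric] power2_eq_square)
    also have "\<dots> = ennreal a * (ennreal \<bar>a\<bar> * (\<integral>\<^sup>+t. ennreal (h (0 + a * t) / (0 + a * t)\<^sup>2) \<partial>lborel))"
      using \<open>a > 0\<close> by (simp add: nn_integral_cmult)
    also have "ennreal \<bar>a\<bar> * (\<integral>\<^sup>+t. ennreal (h (0 + a * t) / (0 + a * t)\<^sup>2) \<partial>lborel) = (\<integral>\<^sup>+u. ennreal (h u / u\<^sup>2) \<partial>lborel)"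
      using \<open>a > 0\<close> by (subst (2) nn_integral_real_affine[where c = a and t = 0]) auto
    finally show ?thesis
      unfolding 1 unfolding h_def using \<open>a > 0\<close> by (simp add: ennreal_mult')
  qed simp
qed

text \<open>The half-angle formula makes this the case of exponent \<open>2\<close>, with \<open>wallis 2 = pi / 2\<close>.\<close>

lemma nn_integral_one_minus_cos:
  "(\<integral>\<^sup>+t. ennreal ((1 - cos (t * s)) / t\<^sup>2) \<partial>lborel) = ennreal (pi * \<bar>s\<bar>)"
proof -
  have e: "(1 - cos (t * s)) / t\<^sup>2 = 2 * ((1 - \<bar>cos (\<bar>s\<bar> / 2 * t)\<bar> powr 2) / t\<^sup>2)" for t
  proof -
    have "cos (t * s) = cos (2 * (\<bar>s\<bar> / 2 * t))"
      by (cases "s \<ge> 0") (simp_all add: mult.commute)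
    also have "\<dots> = 2 * \<bar>cos (\<bar>s\<bar> / 2 * t)\<bar> powr 2 - 1"
      unfolding cos_double_cos[of "\<bar>s\<bar> / 2 * t"] by simp
    finally show ?thesis by simp
  qed
  have "(\<integral>\<^sup>+t. ennreal ((1 - cos (t * s)) / t\<^sup>2) \<partial>lborel)
     = (\<integral>\<^sup>+t. ennreal 2 * ennreal ((1 - \<bar>cos (\<bar>s\<bar> / 2 * t)\<bar> powr 2) / t\<^sup>2) \<partial>lborel)"
    unfolding e by (intro nn_integral_cong ennreal_mult') simp
  also have "\<dots> = ennreal 2 * (\<integral>\<^sup>+t. ennreal ((1 - \<bar>cos (\<bar>s\<bar> / 2 * t)\<bar> powr 2) / t\<^sup>2) \<partial>lborel)"
    by (rule nn_integral_cmult) measurable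
  also have "\<dots> = ennreal 2 * ennreal (\<bar>s\<bar> / 2 * (2 * wallis 2))"
    by (subst nn_integral_one_minus_abs_cos_powr) auto
  also have "\<dots> = ennreal (2 * (\<bar>s\<bar> / 2 * (2 * wallis 2)))"
    by (rule ennreal_mult'[symmetric]) simp
  finally show ?thesis by (simp add: wallis_2 mult.commute)
qed

text \<open>Haagerup's argument: the absolute value is an integral over \<open>1 - cos\<close>, the characteristic
  function of the sum is a product of cosines, and the squares of the weights are the exponents of
  a weighted geometric mean. A weight \<open>0\<close> contributes nothing on the left, in agreement with the
  convention \<open>1 / 0 = 0\<close>.\<close>

theorem avg_abs_lin_ge_wallis:
  assumes fin: "finite I" and norm: "(\<Sum>i\<in>I. (w i)\<^sup>2) = 1"
  shows "(\<Sum>i\<in>I. \<bar>w i\<bar> * wallis (1 / (w i)\<^sup>2)) \<le> pi * avg I (\<lambda>x. \<bar>lin I w x\<bar>)"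
proof -
  have w1: "(w i)\<^sup>2 \<le> 1" if "i \<in> I" for i
    using norm member_le_sum[OF that _ fin, of "\<lambda>i. (w i)\<^sup>2"] by simp
  define y where "y t i = \<bar>cos (\<bar>w i\<bar> * t)\<bar> powr (1 / (w i)\<^sup>2)" for t i
  have y1: "0 \<le> y t i" "y t i \<le> 1" for t i
    unfolding y_def by (auto intro!: powr_le1)
  have "ennreal (\<Sum>i\<in>I. \<bar>w i\<bar> * wallis (1 / (w i)\<^sup>2))
    = (\<Sum>i\<in>I. ennreal ((w i)\<^sup>2) * (\<integral>\<^sup>+t. ennreal ((1 - y t i) / t\<^sup>2) \<partial>lborel))"
  proof (subst sum_ennreal[symmetric])
    show "(\<Sum>i\<in>I. ennreal (\<bar>w i\<bar> * wallis (1 / (w i)\<^sup>2)))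
      = (\<Sum>i\<in>I. ennreal ((w i)\<^sup>2) * (\<integral>\<^sup>+t. ennreal ((1 - y t i) / t\<^sup>2) \<partial>lborel))"
    proof (rule sum.cong[OF refl])
      fix i assume "i \<in> I"
      show "ennreal (\<bar>w i\<bar> * wallis (1 / (w i)\<^sup>2))
        = ennreal ((w i)\<^sup>2) * (\<integral>\<^sup>+t. ennreal ((1 - y t i) / t\<^sup>2) \<partial>lborel)"
      proof (cases "w i = 0")
        case False
        have "1 \<le> 1 / (w i)\<^sup>2" using False w1[OF \<open>i \<in> I\<close>] by simp
        then show ?thesis
          unfolding y_def using False
          by (subst nn_integral_one_minus_abs_cos_powr) (auto simp: ennreal_mult'[symmetric])
      qed simp
    qed
  qed (auto intro!: mult_nonneg_nonneg wallis_nonneg)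
  also have "\<dots> = (\<integral>\<^sup>+t. (\<Sum>i\<in>I. ennreal ((w i)\<^sup>2) * ennreal ((1 - y t i) / t\<^sup>2)) \<partial>lborel)"
    unfolding y_def by (simp add: nn_integral_sum nn_integral_cmult)
  also have "\<dots> \<le> (\<integral>\<^sup>+t. (\<Sum>x\<in>signs I. ennreal (1 / 2 ^ card I) * ennreal ((1 - cos (t * lin I w x)) / t\<^sup>2)) \<partial>lborel)"
  proof (rule nn_integral_mono)
    fix t :: real
    have "(\<Prod>i\<in>I. cos (t * w i)) \<le> (\<Prod>i\<in>I. \<bar>cos (t * w i)\<bar>)"
      using abs_ge_self[of "\<Prod>i\<in>I. cos (t * w i)"] by (simp add: abs_prod)
    also have "\<dots> = (\<Prod>i\<in>I. y t i powr ((w i)\<^sup>2))"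
    proof (rule prod.cong[OF refl])
      fix i
      have "\<bar>cos (t * w i)\<bar> = \<bar>cos (\<bar>w i\<bar> * t)\<bar>" by (cases "w i \<ge> 0") (simp_all add: mult.commute)
      then show "\<bar>cos (t * w i)\<bar> = y t i powr ((w i)\<^sup>2)"
        by (cases "w i = 0") (simp_all add: y_def powr_powr)
    qed
    also have "\<dots> \<le> (\<Sum>i\<in>I. (w i)\<^sup>2 * y t i)"
      using fin norm y1 by (intro weighted_arith_geom_mean) auto
    finally have prod_le: "(\<Prod>i\<in>I. cos (t * w i)) \<le> (\<Sum>i\<in>I. (w i)\<^sup>2 * y t i)" .
    have "(\<Sum>i\<in>I. (w i)\<^sup>2 * ((1 - y t i) / t\<^sup>2)) = (1 - (\<Sum>i\<in>I. (w i)\<^sup>2 * y t i)) / t\<^sup>2"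
      using norm by (simp add: sum_divide_distrib[symmetric] algebra_simps sum_subtractf)
    also have "\<dots> \<le> (1 - (\<Prod>i\<in>I. cos (t * w i))) / t\<^sup>2"
      using prod_le by (intro divide_right_mono) auto
    also have "(\<Prod>i\<in>I. cos (t * w i)) = avg I (\<lambda>x. cos (t * lin I w x))"
      using avg_cos_lin[OF fin, of 0 t w] by simp
    also have "(1 - avg I (\<lambda>x. cos (t * lin I w x))) / t\<^sup>2 = avg I (\<lambda>x. (1 - cos (t * lin I w x)) / t\<^sup>2)"
      using avg_cmult[of I "1 / t\<^sup>2" "\<lambda>x. 1 - cos (t * lin I w x)"]
      by (simp add: avg_diff avg_const fin)
    also have "\<dots> = (\<Sum>x\<in>signs I. 1 / 2 ^ card I * ((1 - cos (t * lin I w x)) / t\<^sup>2))"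
      unfolding avg_def by (simp add: sum_divide_distrib mult.commute)
    finally have "ennreal (\<Sum>i\<in>I. (w i)\<^sup>2 * ((1 - y t i) / t\<^sup>2))
      \<le> ennreal (\<Sum>x\<in>signs I. 1 / 2 ^ card I * ((1 - cos (t * lin I w x)) / t\<^sup>2))"
      by (rule ennreal_leI)
    then show "(\<Sum>i\<in>I. ennreal ((w i)\<^sup>2) * ennreal ((1 - y t i) / t\<^sup>2))
      \<le> (\<Sum>x\<in>signs I. ennreal (1 / 2 ^ card I) * ennreal ((1 - cos (t * lin I w x)) / t\<^sup>2))"
      using y1 by (simp only: sum_ennreal[symmetric] ennreal_mult' zero_le_power2
        mult_nonneg_nonneg divide_nonneg_nonneg zero_le_one zero_le_power zero_le_numeral
        diff_ge_0_iff_ge cos_le_one)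
  qed
  also have "\<dots> = (\<Sum>x\<in>signs I. ennreal (1 / 2 ^ card I) * ennreal (pi * \<bar>lin I w x\<bar>))"
    by (simp add: nn_integral_sum nn_integral_cmult nn_integral_one_minus_cos)
  also have "\<dots> = ennreal (pi * avg I (\<lambda>x. \<bar>lin I w x\<bar>))"
    unfolding avg_def sum_divide_distrib sum_distrib_left
    by (subst sum_ennreal[symmetric]) (auto simp: ennreal_mult'[symmetric] mult_ac)
  finally show ?thesis
    by (subst (asm) ennreal_le_iff) (auto intro!: mult_nonneg_nonneg avg_nonneg)
qed

text \<open>Insert the bound for Wallis integrals of order \<open>1 / (w i)\<^sup>2\<close>, which is at least \<open>1\<close> by the
  normalisation. For many equal weights the right-hand side approaches the Gaussian value
  \<open>sqrt (2 / pi)\<close>.\<close>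

theorem avg_abs_lin_lower_bound:
  assumes fin: "finite I" and norm: "(\<Sum>i\<in>I. (w i)\<^sup>2) = 1"
  shows "sqrt (2 / pi) * (1 - (\<Sum>i\<in>I. w i ^ 4) / 4) \<le> avg I (\<lambda>x. \<bar>lin I w x\<bar>)"
proof -
  have w1: "(w i)\<^sup>2 \<le> 1" if "i \<in> I" for i
    using norm member_le_sum[OF that _ fin, of "\<lambda>i. (w i)\<^sup>2"] by simp
  have "sqrt (2 * pi) * (1 - (\<Sum>i\<in>I. w i ^ 4) / 4) = (\<Sum>i\<in>I. sqrt (2 * pi) * ((w i)\<^sup>2 - w i ^ 4 / 4))"
    using norm by (simp add: sum_distrib_left[symmetric] sum_subtractf sum_divide_distrib)
  also have "\<dots> \<le> (\<Sum>i\<in>I. \<bar>w i\<bar> * wallis (1 / (w i)\<^sup>2))"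
  proof (rule sum_mono)
    fix i assume "i \<in> I"
    show "sqrt (2 * pi) * ((w i)\<^sup>2 - w i ^ 4 / 4) \<le> \<bar>w i\<bar> * wallis (1 / (w i)\<^sup>2)"
    proof (cases "w i = 0")
      case False
      have "1 \<le> 1 / (w i)\<^sup>2" using False w1[OF \<open>i \<in> I\<close>] by simp
      from wallis_lower_bound[OF this]
      have "sqrt (2 * pi) * \<bar>w i\<bar> * (1 - (w i)\<^sup>2 / 4) \<le> wallis (1 / (w i)\<^sup>2)"
        by (simp add: real_sqrt_mult)
      from mult_left_mono[OF this, of "\<bar>w i\<bar>"]
      have "\<bar>w i\<bar> * (sqrt (2 * pi) * \<bar>w i\<bar> * (1 - (w i)\<^sup>2 / 4)) \<le> \<bar>w i\<bar> * wallis (1 / (w i)\<^sup>2)" by simp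
      moreover have "\<bar>w i\<bar> * (sqrt (2 * pi) * \<bar>w i\<bar> * (1 - (w i)\<^sup>2 / 4))
        = sqrt (2 * pi) * (\<bar>w i\<bar>\<^sup>2 * (1 - (w i)\<^sup>2 / 4))" by (simp only: power2_eq_square mult_ac)
      moreover have "\<bar>w i\<bar>\<^sup>2 * (1 - (w i)\<^sup>2 / 4) = (w i)\<^sup>2 - w i ^ 4 / 4"
        by (simp add: algebra_simps power2_eq_square power4_eq_xxxx)
      ultimately show ?thesis by simp
    qed simp
  qed
  also have "\<dots> \<le> pi * avg I (\<lambda>x. \<bar>lin I w x\<bar>)" by (rule avg_abs_lin_ge_wallis[OF fin norm])
  finally have "sqrt (2 * pi) * (1 - (\<Sum>i\<in>I. w i ^ 4) / 4) / pi \<le> avg I (\<lambda>x. \<bar>lin I w x\<bar>)"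
    by (simp add: divide_le_eq mult.commute)
  moreover have "sqrt (2 / pi) = sqrt (2 * pi) / pi"
    by (simp add: real_sqrt_divide real_sqrt_mult real_div_sqrt divide_divide_eq_right[symmetric]
        nonzero_eq_divide_eq del: divide_divide_eq_right) 
  ultimately show ?thesis by simp
qed

lemma avg_lin_sq:
  assumes "finite I"
  shows "avg I (\<lambda>x. (c + lin I w x)\<^sup>2) = c\<^sup>2 + (\<Sum>i\<in>I. (w i)\<^sup>2)"
  using assms
proof (induction arbitrary: c)
  case (insert i I)
  have "avg (insert i I) (\<lambda>x. (c + lin (insert i I) w x)\<^sup>2)
    = (((c + w i)\<^sup>2 + (\<Sum>i\<in>I. (w i)\<^sup>2)) + ((c - w i)\<^sup>2 + (\<Sum>i\<in>I. (w i)\<^sup>2))) / 2"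
    using insert.IH[of "c + w i"] insert.IH[of "c - w i"]
      avg_lin_insert[OF insert.hyps(1,2), of "\<lambda>r. (c + r)\<^sup>2" w]
    by (simp add: algebra_simps)
  then show ?case using insert.hyps by (simp add: power2_eq_square field_simps)
qed (simp add: avg_empty lin_def)

text \<open>Conditioning on the other signs and convexity of the absolute value.\<close>

lemma avg_abs_lin_ge_coeff:
  assumes "finite I" "i \<in> I"
  shows "\<bar>w i\<bar> \<le> avg I (\<lambda>x. \<bar>lin I w x\<bar>)"
proof -
  obtain J where J: "I = insert i J" "i \<notin> J" using mk_disjoint_insert[OF assms(2)] by blast
  then have fin: "finite J" using assms(1) by simp
  have "2 * \<bar>w i\<bar> = avg J (\<lambda>x. 2 * \<bar>w i\<bar>)" by (simp add: avg_const fin)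
  also have "\<dots> \<le> avg J (\<lambda>x. \<bar>w i + lin J w x\<bar> + \<bar>- w i + lin J w x\<bar>)"
    by (rule avg_mono) linarith
  finally show ?thesis
    unfolding J(1) by (simp add: avg_lin_insert[OF fin J(2)] avg_add)
qed

lemma lin_scale: "lin I (\<lambda>i. w i / r) x = lin I w x / r"
  unfolding lin_def by (simp add: sum_divide_distrib)

text \<open>From \<open>sin (pi / 6) = 1 / 2\<close> and \<open>x - x ^ 3 / 6 \<le> sin x\<close>, where \<open>x - x ^ 3 / 6\<close> exceeds
  \<open>1 / 2\<close> at \<open>x = 3.15 / 6\<close>.\<close>

lemma pi_le: "pi \<le> 3.15"
proof (rule ccontr)
  assume "\<not> pi \<le> 3.15"
  then have big: "0.525 \<le> pi / 6" by simp
  define f where "f x = sin x - x + x ^ 3 / 6" for x :: real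
  have "f 0 \<le> f 0.525"
  proof (rule DERIV_nonneg_imp_nondecreasing[of 0 "0.525" f])
    fix x :: real assume "0 \<le> x" "x \<le> 0.525"
    have "\<bar>sin (x / 2)\<bar> \<le> \<bar>x / 2\<bar>" by (rule abs_sin_x_le_abs_x)
    then have "(sin (x / 2))\<^sup>2 \<le> (x / 2)\<^sup>2" using abs_le_square_iff by blast
    moreover have "cos x = 1 - 2 * (sin (x / 2))\<^sup>2"
      using cos_double_sin[of "x / 2"] by simp
    ultimately have "0 \<le> cos x - 1 + x\<^sup>2 / 2" by (simp add: power_divide)
    moreover have "(f has_real_derivative (cos x - 1 + x\<^sup>2 / 2)) (at x)"
      unfolding f_def by (auto intro!: derivative_eq_intros simp: power2_eq_square)
    ultimately show "\<exists>y. (f has_real_derivative y) (at x) \<and> 0 \<le> y" by blast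
  qed simp
  then have "0.5 < sin (0.525 :: real)" by (simp add: f_def power3_eq_cube)
  also have "\<dots> \<le> sin (pi / 6)" using big pi_gt_zero by (intro sin_monotone_2pi_le) auto
  finally show False by (simp add: sin_30)
qed

lemma sqrt_2_over_pi_ge: "0.7968 \<le> sqrt (2 / pi)"
proof (rule real_le_rsqrt)
  have "0.7968\<^sup>2 \<le> 2 / (3.15 :: real)" by (simp add: power2_eq_square)
  also have "\<dots> \<le> 2 / pi" using pi_le by (intro divide_left_mono) auto
  finally show "0.7968\<^sup>2 \<le> 2 / pi" .
qed

lemma avg_abs_lin_ge:
  assumes "finite I" "(\<Sum>i\<in>I. (w i)\<^sup>2) = 1" "(\<Sum>i\<in>I. w i ^ 4) \<le> T" "T \<le> 4"
  shows "0.7968 * (1 - T / 4) \<le> avg I (\<lambda>x. \<bar>lin I w x\<bar>)"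
proof -
  have "0.7968 * (1 - T / 4) \<le> sqrt (2 / pi) * (1 - (\<Sum>i\<in>I. w i ^ 4) / 4)"
    using assms sqrt_2_over_pi_ge by (intro mult_mono) auto
  also have "\<dots> \<le> avg I (\<lambda>x. \<bar>lin I w x\<bar>)" by (rule avg_abs_lin_lower_bound[OF assms(1,2)])
  finally show ?thesis .
qed

text \<open>Szarek's constant is \<open>1 / sqrt 2\<close>; the value \<open>0.69\<close> follows at once from
  \<open>avg_abs_lin_ge_coeff\<close> and \<open>avg_abs_lin_ge\<close>. Either some normalised weight is at least \<open>0.69\<close>,
  or the sum of the fourth powers is at most \<open>0.69\<^sup>2\<close>.\<close>

lemma khintchine_weak:
  assumes fin: "finite I"
  shows "69 / 100 * sqrt (\<Sum>i\<in>I. (w i)\<^sup>2) \<le> avg I (\<lambda>x. \<bar>lin I w x\<bar>)"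
proof -
  define r where "r = sqrt (\<Sum>i\<in>I. (w i)\<^sup>2)"
  have r2: "r\<^sup>2 = (\<Sum>i\<in>I. (w i)\<^sup>2)" by (simp add: r_def sum_nonneg)
  show ?thesis
  proof (cases "r = 0")
    case True
    then show ?thesis by (auto simp: r_def intro!: avg_nonneg)
  next
    case False
    then have r: "r > 0" by (simp add: r_def less_le sum_nonneg)
    define u where "u i = w i / r" for i
    have u: "(\<Sum>i\<in>I. (u i)\<^sup>2) = 1"
      using r by (simp add: u_def power_divide sum_divide_distrib[symmetric] r2[symmetric])
    have "69 / 100 \<le> avg I (\<lambda>x. \<bar>lin I u x\<bar>)"
    proof (cases "\<exists>i\<in>I. 69 / 100 \<le> \<bar>u i\<bar>")
      case True
      then show ?thesis using avg_abs_lin_ge_coeff[OF fin] order_trans by blast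
    next
      case False
      have "(\<Sum>i\<in>I. u i ^ 4) \<le> (\<Sum>i\<in>I. 0.4761 * (u i)\<^sup>2)"
      proof (rule sum_mono)
        fix i assume "i \<in> I"
        then have "\<bar>u i\<bar> \<le> 69 / 100" using False by force
        then have "\<bar>u i\<bar>\<^sup>2 \<le> (69 / 100)\<^sup>2" by (intro power_mono) auto
        then have "(u i)\<^sup>2 * (u i)\<^sup>2 \<le> 0.4761 * (u i)\<^sup>2"
          by (intro mult_right_mono) (auto simp: power2_eq_square)
        then show "u i ^ 4 \<le> 0.4761 * (u i)\<^sup>2" by (simp add: power4_eq_xxxx power2_eq_square)
      qed
      also have "\<dots> = 0.4761" unfolding sum_distrib_left[symmetric] u by simp
      finally have "0.7968 * (1 - 0.4761 / 4) \<le> avg I (\<lambda>x. \<bar>lin I u x\<bar>)"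
        by (intro avg_abs_lin_ge[OF fin u]) auto
      then show ?thesis by simp
    qed
    moreover have "avg I (\<lambda>x. \<bar>lin I u x\<bar>) = avg I (\<lambda>x. \<bar>lin I w x\<bar>) / r"
    proof -
      have "lin I u x = lin I w x / r" for x
        using lin_scale[of I w r x] by (simp add: u_def[abs_def])
      then show ?thesis
        using avg_cmult[of I "1 / r" "\<lambda>x. \<bar>lin I w x\<bar>"] r by (simp add: abs_divide)
    qed
    ultimately show ?thesis using r by (simp add: le_divide_eq r_def[symmetric])
  qed
qed

section \<open>Two distinguished coordinates\<close>

lemma lin_upd_other: "i \<notin> I \<Longrightarrow> lin I w (x(i := e)) = lin I w x"
  unfolding lin_def by (intro sum.cong) auto

lemma avg_insert2:
  assumes "finite I" "p \<noteq> q" "p \<notin> I" "q \<notin> I"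
  shows "avg (insert p (insert q I)) (\<lambda>x. G (x p) (x q) (lin (insert p (insert q I)) w x) (lin I v x))
   = (avg I (\<lambda>x. G 1 1 (w p + w q + lin I w x) (lin I v x))
    + avg I (\<lambda>x. G 1 (-1) (w p - w q + lin I w x) (lin I v x))
    + avg I (\<lambda>x. G (-1) 1 (- (w p - w q) + lin I w x) (lin I v x))
    + avg I (\<lambda>x. G (-1) (-1) (- (w p + w q) + lin I w x) (lin I v x))) / 4"
proof -
  have "p \<notin> insert q I" using assms by auto
  then show ?thesis using assms
    by (simp add: avg_insert lin_insert_upd lin_upd_other add.commute add.left_commute)
       (simp add: algebra_simps add_divide_distrib)
qed

text \<open>Bessel's inequality for the vector \<open>c\<close> and two orthogonal directions: the sum of the unit
  vectors at \<open>p\<close> and \<open>q\<close>, and \<open>d / 2\<close> times their difference plus the vector \<open>w\<close> on \<open>I\<close>. It is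
  multiplied by the squared length of the second direction, which may vanish.\<close>

lemma bessel_two:
  fixes c w :: "'i \<Rightarrow> real"
  assumes "finite I" "p \<noteq> q" "p \<notin> I" "q \<notin> I"
  shows "(\<Sum>i\<in>insert p (insert q I). (c i)\<^sup>2) * (d\<^sup>2 / 2 + (\<Sum>i\<in>I. (w i)\<^sup>2))
    \<ge> (c p + c q)\<^sup>2 / 2 * (d\<^sup>2 / 2 + (\<Sum>i\<in>I. (w i)\<^sup>2))
       + (d * (c p - c q) / 2 + (\<Sum>i\<in>I. w i * c i))\<^sup>2"
proof -
  \<comment> \<open>The coordinate \<open>p\<close> is reused for the normalised difference of the two leading coordinates.\<close>
  define x y where "x = c(p := (c p - c q) / sqrt 2)" and "y = w(p := d / sqrt 2)"
  have same: "(\<Sum>i\<in>I. g (x i) (y i)) = (\<Sum>i\<in>I. g (c i) (w i))" for g :: "real \<Rightarrow> real \<Rightarrow> real"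
    using assms(3) by (intro sum.cong) (auto simp: x_def y_def)
  have "(\<Sum>i\<in>insert p I. x i * y i)\<^sup>2 \<le> (\<Sum>i\<in>insert p I. (x i)\<^sup>2) * (\<Sum>i\<in>insert p I. (y i)\<^sup>2)"
    by (rule Cauchy_Schwarz_ineq_sum)
  then have "(d * (c p - c q) / 2 + (\<Sum>i\<in>I. w i * c i))\<^sup>2
    \<le> ((c p - c q)\<^sup>2 / 2 + (\<Sum>i\<in>I. (c i)\<^sup>2)) * (d\<^sup>2 / 2 + (\<Sum>i\<in>I. (w i)\<^sup>2))"
    using assms same[of "\<lambda>a b. a * b"] same[of "\<lambda>a b. a\<^sup>2"] same[of "\<lambda>a b. b\<^sup>2"]
    by (simp add: x_def y_def power_divide mult_ac)
  moreover have "(\<Sum>i\<in>insert p (insert q I). (c i)\<^sup>2)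
    = (c p + c q)\<^sup>2 / 2 + ((c p - c q)\<^sup>2 / 2 + (\<Sum>i\<in>I. (c i)\<^sup>2))"
    using assms by (simp add: power2_eq_square field_simps)
  ultimately show ?thesis by (simp add: distrib_right)
qed

lemma sq_avg_abs_lin_le_weight:
  assumes "(\<Sum>i\<in>J. (w i)\<^sup>2) = 1"
  shows "(avg J (\<lambda>x. \<bar>lin J w x\<bar>))\<^sup>2 \<le> (\<Sum>i\<in>J. (avg J (\<lambda>x. sgn (lin J w x) * x i))\<^sup>2)"
proof -
  have "avg J (\<lambda>x. \<bar>lin J w x\<bar>) = avg J (\<lambda>x. \<Sum>i\<in>J. w i * (sgn (lin J w x) * x i))"
  proof (rule avg_cong)
    fix x
    have "\<bar>lin J w x\<bar> = sgn (lin J w x) * lin J w x" by (simp add: abs_sgn mult.commute)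
    also have "\<dots> = (\<Sum>i\<in>J. w i * (sgn (lin J w x) * x i))"
    proof -
      have "e * lin J w x = (\<Sum>i\<in>J. w i * (e * x i))" for e
        unfolding lin_def sum_distrib_left by (intro sum.cong) auto
      then show ?thesis .
    qed
    finally show "\<bar>lin J w x\<bar> = (\<Sum>i\<in>J. w i * (sgn (lin J w x) * x i))" .
  qed
  also have "\<dots> = (\<Sum>i\<in>J. w i * avg J (\<lambda>x. sgn (lin J w x) * x i))"
    by (simp only: avg_sum avg_cmult)
  finally show ?thesis
    using Cauchy_Schwarz_ineq_sum[of w "\<lambda>i. avg J (\<lambda>x. sgn (lin J w x) * x i)" J] assms by simp
qed

context
  fixes I :: "'i set" and p q :: 'i and w :: "'i \<Rightarrow> real"
  assumes fin: "finite I" and pq: "p \<noteq> q" and pI: "p \<notin> I" and qI: "q \<notin> I"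
begin

lemmas avg_split = avg_insert2[OF fin pq pI qI]

text \<open>This is \<open>khintchine_weak\<close> for the form on \<open>insert p I\<close> that has weight \<open>d\<close> at \<open>p\<close>.\<close>

lemma avg_abs_shift_ge:
  "2 * (69 / 100 * sqrt (d\<^sup>2 + (\<Sum>i\<in>I. (w i)\<^sup>2)))
    \<le> avg I (\<lambda>x. \<bar>d + lin I w x\<bar>) + avg I (\<lambda>x. \<bar>- d + lin I w x\<bar>)"
proof -
  define u where "u = w(p := d)"
  have "lin I u = lin I w" using pI unfolding lin_def u_def by (intro ext sum.cong) auto
  moreover have "(\<Sum>i\<in>I. (u i)\<^sup>2) = (\<Sum>i\<in>I. (w i)\<^sup>2)" using pI unfolding u_def by (intro sum.cong) auto
  ultimately show ?thesis
    using khintchine_weak[of "insert p I" u] fin pI avg_lin_insert[OF fin pI, of abs u]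
    by (simp add: u_def)
qed

text \<open>Averaging over the two leading signs replaces \<open>\<bar>S\<bar>\<close> by the mean of \<open>max s \<bar>R\<bar>\<close> and
  \<open>max \<bar>d\<bar> \<bar>R\<bar>\<close>, with \<open>s\<close> the sum and \<open>d\<close> the difference of the leading weights and \<open>R\<close> the rest
  of the form.\<close>

lemma avg_abs_lin_pair_ge:
  assumes "0 \<le> w p" "0 \<le> w q"
  shows "(w p + w q + max \<bar>w p - w q\<bar> (69 / 100 * sqrt (\<Sum>i\<in>I. (w i)\<^sup>2))) / 2
    \<le> avg (insert p (insert q I)) (\<lambda>x. \<bar>lin (insert p (insert q I)) w x\<bar>)"
proof -
  let ?J = "insert p (insert q I)" and ?v = "\<Sum>i\<in>I. (w i)\<^sup>2"
  let ?A = "\<lambda>c. avg I (\<lambda>x. \<bar>c + lin I w x\<bar>)"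
  have two: "2 * \<bar>c\<bar> \<le> ?A c + ?A (- c)" for c
  proof -
    have "2 * \<bar>c\<bar> = avg I (\<lambda>x. 2 * \<bar>c\<bar>)" by (simp add: avg_const fin)
    also have "\<dots> \<le> avg I (\<lambda>x. \<bar>c + lin I w x\<bar> + \<bar>- c + lin I w x\<bar>)"
      by (rule avg_mono) linarith
    finally show ?thesis by (simp add: avg_add)
  qed
  have "sqrt ?v \<le> sqrt ((w p - w q)\<^sup>2 + ?v)" by simp
  with avg_abs_shift_ge[of "w p - w q"]
  have "2 * (69 / 100 * sqrt ?v) \<le> ?A (w p - w q) + ?A (- (w p - w q))" by linarith
  moreover have "avg ?J (\<lambda>x. \<bar>lin ?J w x\<bar>)
    = (?A (w p + w q) + ?A (w p - w q) + ?A (- (w p - w q)) + ?A (- (w p + w q))) / 4"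
    by (rule avg_split[of "\<lambda>_ _ r _. \<bar>r\<bar>"])
  ultimately show ?thesis
    using two[of "w p + w q"] two[of "w p - w q"] assms by (simp add: max_def)
qed

text \<open>With \<open>s\<close>, \<open>d\<close> and \<open>R\<close> as before: if \<open>x p = x q\<close> and \<open>\<bar>R\<bar> < s\<close>, the leading signs decide the
  sign of the form, and Chebyshev's inequality bounds the probability of \<open>\<bar>R\<bar> \<ge> s\<close>. This gives the
  coefficient in the direction \<open>x p + x q\<close>. If \<open>x p = - x q\<close>, the form itself is \<open>\<plusminus>d + R\<close>, so its
  coefficient in the direction of \<open>d * (x p - x q) / 2 + R\<close> is the first moment of a Rademacher
  sum. Nonvanishing of the form is essential: for two equal weights and \<open>R = 0\<close> the sum on the
  right is only \<open>1 / 2\<close>.\<close>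

lemma near_extremal_weight:
  assumes s: "0 < w p + w q"
    and nz: "\<And>x. x \<in> signs (insert p (insert q I)) \<Longrightarrow> lin (insert p (insert q I)) w x \<noteq> 0"
    and small: "(\<Sum>i\<in>I. (w i)\<^sup>2) \<le> (w p + w q)\<^sup>2"
  shows "(1 - (\<Sum>i\<in>I. (w i)\<^sup>2) / (w p + w q)\<^sup>2)\<^sup>2 / 2 + (69 / 100)\<^sup>2 / 4
    \<le> (\<Sum>i\<in>insert p (insert q I).
          (avg (insert p (insert q I)) (\<lambda>x. sgn (lin (insert p (insert q I)) w x) * x i))\<^sup>2)"
proof -
  let ?J = "insert p (insert q I)" and ?v = "\<Sum>i\<in>I. (w i)\<^sup>2"
  define s d where "s = w p + w q" and "d = w p - w q"
  define c where "c i = avg ?J (\<lambda>x. sgn (lin ?J w x) * x i)" for i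
  let ?R = "lin I w"
  have s0: "0 < s" using s by (simp add: s_def)
  have rr0: "0 \<le> ?v" by (simp add: sum_nonneg)
  have N: "0 < d\<^sup>2 / 2 + ?v"
  proof (rule ccontr)
    assume "\<not> 0 < d\<^sup>2 / 2 + ?v"
    moreover have "0 \<le> d\<^sup>2" by simp
    ultimately have "d\<^sup>2 = 0" "?v = 0" using rr0 by linarith+
    then have "d = 0" "\<And>i. i \<in> I \<Longrightarrow> w i = 0" using fin by (simp_all add: sum_nonneg_eq_0_iff)
    \<comment> \<open>otherwise the form would vanish at a point with \<open>x p = - x q\<close>\<close>
    define x where "x = (\<lambda>i\<in>?J. if i = q then - 1 else (1::real))"
    have "lin I w x = 0" unfolding lin_def using \<open>\<And>i. i \<in> I \<Longrightarrow> w i = 0\<close> by simp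
    then have "lin ?J w x = d" using fin pq pI qI by (simp add: lin_def x_def d_def)
    moreover have "x \<in> signs ?J" unfolding x_def signs_def by auto
    ultimately show False using nz \<open>d = 0\<close> by blast
  qed
  have sum: "1 - ?v / s\<^sup>2 \<le> c p + c q"
  proof -
    \<comment> \<open>the pointwise form of Chebyshev's inequality\<close>
    have pt: "2 - 2 / s\<^sup>2 * (0 + r)\<^sup>2 \<le> sgn (s + r) - sgn (- s + r)" for r
    proof (cases "\<bar>r\<bar> < s")
      case True
      then show ?thesis by simp
    next
      case False
      then have "s\<^sup>2 \<le> \<bar>r\<bar>\<^sup>2" using s0 by (intro power_mono) auto
      then have "2 - 2 / s\<^sup>2 * (0 + r)\<^sup>2 \<le> 0" using s0 by (simp add: field_simps)
      moreover have "sgn (- s + r) \<le> sgn (s + r)" using s0 by (auto simp: sgn_real_def)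
      ultimately show ?thesis by linarith
    qed
    have "2 - 2 / s\<^sup>2 * ?v = avg I (\<lambda>x. 2 - 2 / s\<^sup>2 * (0 + ?R x)\<^sup>2)"
      by (simp only: avg_diff avg_cmult avg_const[OF fin] avg_lin_sq[OF fin]) simp
    also have "\<dots> \<le> avg I (\<lambda>x. sgn (s + ?R x) - sgn (- s + ?R x))"
      by (rule avg_mono) (rule pt)
    also have "\<dots> = 2 * (c p + c q)"
    proof -
      have "c p + c q = avg ?J (\<lambda>x. sgn (lin ?J w x) * (x p + x q))"
        unfolding c_def avg_add[symmetric] distrib_left[symmetric] ..
      also have "\<dots> = (avg I (\<lambda>x. 2 * sgn (s + ?R x)) + avg I (\<lambda>x. 0) + avg I (\<lambda>x. 0)
          + avg I (\<lambda>x. (-2) * sgn (- s + ?R x))) / 4"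
        by (subst avg_split[of "\<lambda>e1 e2 r _. sgn r * (e1 + e2)"]) (simp add: s_def mult.commute)
      finally show ?thesis by (simp only: avg_cmult avg_diff avg_const[OF fin]) simp
    qed
    finally show ?thesis by simp
  qed
  have diff: "69 / 100 / 2 * sqrt (d\<^sup>2 + ?v) \<le> d * (c p - c q) / 2 + (\<Sum>i\<in>I. w i * c i)"
  proof -
    have "d * (c p - c q) / 2 + (\<Sum>i\<in>I. w i * c i)
      = avg ?J (\<lambda>x. sgn (lin ?J w x) * (d * (x p - x q) / 2 + ?R x))"
    proof -
      have "d * (c p - c q) / 2 = avg ?J (\<lambda>x. d / 2 * (sgn (lin ?J w x) * x p - sgn (lin ?J w x) * x q))"
        by (simp only: avg_cmult avg_diff c_def)
      moreover have "(\<Sum>i\<in>I. w i * c i) = avg ?J (\<lambda>x. sgn (lin ?J w x) * ?R x)"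
        unfolding c_def avg_cmult[symmetric] avg_sum[symmetric] lin_def[of I] sum_distrib_left
        by (intro avg_cong sum.cong) (auto simp: mult_ac)
      moreover have "avg ?J (\<lambda>x. sgn (lin ?J w x) * (d * (x p - x q) / 2 + ?R x))
        = avg ?J (\<lambda>x. d / 2 * (sgn (lin ?J w x) * x p
            - sgn (lin ?J w x) * x q) + sgn (lin ?J w x) * ?R x)"
        by (intro avg_cong) (simp add: field_simps)
      ultimately show ?thesis by (simp only: avg_add)
    qed
    also have "\<dots> = (avg I (\<lambda>x. sgn (s + ?R x) * ?R x) + avg I (\<lambda>x. \<bar>d + ?R x\<bar>)
        + avg I (\<lambda>x. \<bar>- d + ?R x\<bar>) + avg I (\<lambda>x. sgn (- s + ?R x) * ?R x)) / 4"
      by (subst avg_split[of "\<lambda>e1 e2 r t. sgn r * (d * (e1 - e2) / 2 + t)"])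
         (simp add: s_def d_def[symmetric] sgn_mult_self_eq abs_sgn[symmetric] mult.commute)
    finally have e: "d * (c p - c q) / 2 + (\<Sum>i\<in>I. w i * c i) = \<dots>" .
    \<comment> \<open>on the half \<open>x p = x q\<close> the sign is positively correlated with \<open>R\<close>, so this half may be
      dropped\<close>
    have "0 \<le> avg I (\<lambda>x. sgn (s + ?R x) * ?R x + sgn (- s + ?R x) * ?R x)"
    proof (rule avg_nonneg)
      fix x
      show "0 \<le> sgn (s + ?R x) * ?R x + sgn (- s + ?R x) * ?R x"
        using s0 by (auto simp: sgn_real_def)
    qed
    then show ?thesis
      unfolding e using avg_abs_shift_ge[of d] by (simp add: avg_add)
  qed
  have dr: "0 < d\<^sup>2 + ?v" using N zero_le_power2[of d] by linarith
  have "(69 / 100 / 2 * sqrt (d\<^sup>2 + ?v))\<^sup>2 \<le> (d * (c p - c q) / 2 + (\<Sum>i\<in>I. w i * c i))\<^sup>2"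
    using diff by (rule power_mono) (use dr in simp)
  then have 1: "(69 / 100)\<^sup>2 / 4 * (d\<^sup>2 + ?v) \<le> (d * (c p - c q) / 2 + (\<Sum>i\<in>I. w i * c i))\<^sup>2"
    using dr by (simp add: power_mult_distrib power_divide)
  have "(1 - ?v / s\<^sup>2)\<^sup>2 \<le> (c p + c q)\<^sup>2"
    using sum small s0 by (intro power_mono) (auto simp: s_def)
  then have 2: "(1 - ?v / s\<^sup>2)\<^sup>2 / 2 * (d\<^sup>2 / 2 + ?v) \<le> (c p + c q)\<^sup>2 / 2 * (d\<^sup>2 / 2 + ?v)"
    using N by (intro mult_right_mono) auto
  have "(69 / 100)\<^sup>2 / 4 * (d\<^sup>2 / 2 + ?v) \<le> (69 / 100)\<^sup>2 / 4 * (d\<^sup>2 + ?v)"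
    by (intro mult_left_mono) auto
  then have "((1 - ?v / s\<^sup>2)\<^sup>2 / 2 + (69 / 100)\<^sup>2 / 4) * (d\<^sup>2 / 2 + ?v)
    \<le> (\<Sum>i\<in>?J. (c i)\<^sup>2) * (d\<^sup>2 / 2 + ?v)"
    using 1 2 bessel_two[OF fin pq pI qI, of c d w]
    by (simp only: distrib_right)
  then show ?thesis using N unfolding c_def s_def by simp
qed

end

section \<open>Case analysis on the two largest weights\<close>

lemma fourth_powers_le:
  fixes w :: "'i \<Rightarrow> real"
  assumes "\<And>i. i \<in> I \<Longrightarrow> 0 \<le> w i" "\<And>i. i \<in> I \<Longrightarrow> w i \<le> b"
  shows "(\<Sum>i\<in>I. w i ^ 4) \<le> b\<^sup>2 * (\<Sum>i\<in>I. (w i)\<^sup>2)"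
  unfolding sum_distrib_left
proof (rule sum_mono)
  fix i assume "i \<in> I"
  then have "(w i)\<^sup>2 * (w i)\<^sup>2 \<le> b\<^sup>2 * (w i)\<^sup>2"
    using assms by (intro mult_right_mono power_mono) auto
  then show "w i ^ 4 \<le> b\<^sup>2 * (w i)\<^sup>2" by (simp add: power4_eq_xxxx power2_eq_square)
qed

text \<open>For \<open>a + b\<close> equal to its bound \<open>1.0404\<close> the fourth powers of \<open>a\<close> cancel and a cubic in \<open>a\<close>
  remains, whose maximum for \<open>a\<close> between \<open>0.5202\<close> and \<open>0.7302\<close> is attained at the right end and is
  about \<open>0.3292\<close>. For smaller \<open>a\<close> the left-hand side is at most \<open>a\<^sup>2\<close>, because \<open>b \<le> a\<close>.\<close>

lemma fourth_power_numeric: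
  fixes a b :: real
  assumes "0 \<le> b" "b \<le> a" "a + b \<le> 10404 / 10000" "a \<le> 7302 / 10000"
  shows "a ^ 4 + b\<^sup>2 * (1 - a\<^sup>2) \<le> 33 / 100"
proof -
  have a2: "a\<^sup>2 \<le> (7302 / 10000)\<^sup>2" using assms by (intro power_mono) auto
  then have a1: "0 \<le> 1 - a\<^sup>2" by (simp add: power2_eq_square)
  show ?thesis
  proof (cases "a \<le> 5202 / 10000")
    case True
    have "b\<^sup>2 * (1 - a\<^sup>2) \<le> a\<^sup>2 * (1 - a\<^sup>2)"
      using assms a1 by (intro mult_right_mono power_mono) auto
    then have "a ^ 4 + b\<^sup>2 * (1 - a\<^sup>2) \<le> a\<^sup>2"
      by (simp add: power4_eq_xxxx power2_eq_square algebra_simps)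
    also have "\<dots> \<le> (5202 / 10000)\<^sup>2" using True assms by (intro power_mono) auto
    finally show ?thesis by (simp add: power2_eq_square)
  next
    case False
    \<comment> \<open>the chord bounds the cubic term from above, the tangent below bounds the square from below;
      both are nearly tight at \<open>a = 0.73\<close>\<close>
    have chord: "(a - l) * (u - a) * (a + l + u) = (l\<^sup>2 + l * u + u\<^sup>2) * a - l * u * (l + u) - a ^ 3" for l u
      by (simp add: power3_eq_cube power2_eq_square algebra_simps)
    have tangent: "(a - c)\<^sup>2 = a\<^sup>2 - 2 * c * a + c\<^sup>2" for c
      by (simp add: power2_eq_square algebra_simps)
    have expand: "a ^ 4 + (m - a)\<^sup>2 * (1 - a\<^sup>2) = m\<^sup>2 - 2 * m * a + (1 - m\<^sup>2) * a\<^sup>2 + 2 * m * a ^ 3" for m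
      by (simp add: power4_eq_xxxx power3_eq_cube power2_eq_square algebra_simps)
    have "b\<^sup>2 * (1 - a\<^sup>2) \<le> (10404 / 10000 - a)\<^sup>2 * (1 - a\<^sup>2)"
      using assms a1 by (intro mult_right_mono power_mono) auto
    then have "a ^ 4 + b\<^sup>2 * (1 - a\<^sup>2) \<le> 108243216 / 100000000 - 20808 / 10000 * a
        - 8243216 / 100000000 * a\<^sup>2 + 20808 / 10000 * a ^ 3"
      using expand[of "10404 / 10000"] by (simp add: power2_eq_square)
    moreover have "a ^ 3 \<le> 118366 / 100000 * a - 4749 / 10000"
    proof -
      have "0 \<le> (a - 5202 / 10000) * (7302 / 10000 - a) * (a + 5202 / 10000 + 7302 / 10000)"
        using assms False by (intro mult_nonneg_nonneg) auto
      then have "a ^ 3 \<le> ((5202 / 10000)\<^sup>2 + 5202 / 10000 * (7302 / 10000) + (7302 / 10000)\<^sup>2) * a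
          - 5202 / 10000 * (7302 / 10000) * (5202 / 10000 + 7302 / 10000)"
        unfolding chord by linarith
      also have "\<dots> \<le> 118366 / 100000 * a - 4749 / 10000"
        using False by (intro diff_mono mult_right_mono) (simp_all add: power2_eq_square)
      finally show ?thesis .
    qed
    moreover have "146 / 100 * a - 5329 / 10000 \<le> a\<^sup>2"
      using tangent[of "73 / 100"] zero_le_power2[of "a - 73 / 100"] by (simp add: power2_eq_square)
    ultimately show ?thesis using assms(4) by linarith
  qed
qed

text \<open>Here \<open>s\<close> and \<open>d\<close> are the sum and the difference of the two largest weights and \<open>r\<close> is the
  norm of the others. Both \<open>d\<close> and \<open>0.69 r\<close> are below \<open>y = 1.4604 - s\<close>, so the normalisation
  becomes a quadratic inequality for \<open>y\<close>, which fails between its roots \<open>0.0509\<dots>\<close> and \<open>0.4200\<dots>\<close>.\<close>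

lemma sphere_dichotomy:
  fixes s d r :: real
  assumes norm: "s\<^sup>2 + d\<^sup>2 + 2 * r\<^sup>2 = 2" and nn: "0 \<le> s" "0 \<le> d" "0 \<le> r"
    and d: "s + d < 14604 / 10000" and r: "s + 69 / 100 * r < 14604 / 10000"
  shows "s \<le> 10404 / 10000 \<or> (r\<^sup>2 \<le> 6 / 1000 \<and> 19 / 10 \<le> s\<^sup>2)"
proof -
  define y where "y = 14604 / 10000 - s"
  have y: "0 < y" using d nn by (simp add: y_def)
  have s: "s = 14604 / 10000 - y" by (simp add: y_def)
  have dy: "d\<^sup>2 \<le> y\<^sup>2" using d nn by (intro power_mono) (auto simp: y_def)
  have "69 / 100 * r \<le> y" using r by (simp add: y_def)
  then have "(69 / 100 * r)\<^sup>2 \<le> y\<^sup>2" using nn by (intro power_mono) auto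
  then have ry: "4761 * r\<^sup>2 \<le> 10000 * y\<^sup>2" by (simp add: power_mult_distrib power_divide)
  have q: "2 \<le> (14604 / 10000 - y)\<^sup>2 + y\<^sup>2 + 20000 / 4761 * y\<^sup>2"
    using norm dy ry unfolding s by linarith
  have "y \<le> 51 / 1000 \<or> 42 / 100 \<le> y"
  proof (rule ccontr)
    assume "\<not> ?thesis"
    then have "0 < (y - 51 / 1000) * (42 / 100 - y)" by (intro mult_pos_pos) auto
    moreover have "(y - l) * (u - y) = (l + u) * y - l * u - y\<^sup>2" for l u
      by (simp add: power2_eq_square algebra_simps)
    ultimately have "0 < (51 / 1000 + 42 / 100) * y - 51 / 1000 * (42 / 100) - y\<^sup>2" by simp
    then have "y\<^sup>2 < 471 / 1000 * y - 2142 / 100000" by simp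
    moreover have "(14604 / 10000 - y)\<^sup>2 = 213276816 / 100000000 - 29208 / 10000 * y + y\<^sup>2"
      by (simp add: power2_eq_square algebra_simps)
    ultimately show False using q y by linarith
  qed
  then show ?thesis
  proof
    assume "42 / 100 \<le> y"
    then show ?thesis by (simp add: y_def)
  next
    assume "y \<le> 51 / 1000"
    then have "y\<^sup>2 \<le> (51 / 1000)\<^sup>2" using y by (intro power_mono) auto
    then have "r\<^sup>2 \<le> 6 / 1000" using ry by (simp add: power2_eq_square)
    moreover have "(14 / 10)\<^sup>2 \<le> s\<^sup>2" using \<open>y \<le> 51 / 1000\<close> by (intro power_mono) (auto simp: y_def)
    ultimately show ?thesis by (simp add: power2_eq_square)
  qed
qed

lemma target_bounds:
  "(1 / sqrt 2 + 277 / 12000)\<^sup>2 > (0.53317 :: real)"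
  "(1 / sqrt 2 + 277 / 12000)\<^sup>2 \<le> (7302 / 10000 :: real)\<^sup>2"
proof -
  have e: "1 / sqrt 2 = sqrt 2 / 2" by (simp add: real_div_sqrt field_simps)
  have lo: "1.41421 \<le> sqrt (2 :: real)" by (rule real_le_rsqrt) (simp add: power2_eq_square)
  have hi: "sqrt (2 :: real) \<le> 1.41422" by (rule real_le_lsqrt) (simp_all add: power2_eq_square)
  have "(0.53317 :: real) < (1.41421 / 2 + 277 / 12000)\<^sup>2" by (simp add: power2_eq_square)
  also have "\<dots> \<le> (sqrt 2 / 2 + 277 / 12000)\<^sup>2" using lo by (intro power_mono) auto
  finally show "(1 / sqrt 2 + 277 / 12000)\<^sup>2 > (0.53317 :: real)" unfolding e .
  show "(1 / sqrt 2 + 277 / 12000)\<^sup>2 \<le> (7302 / 10000 :: real)\<^sup>2"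
    unfolding e using hi by (intro power_mono) auto
qed

text \<open>If the first moment is below \<open>0.7302\<close>, \<open>avg_abs_lin_pair_ge\<close> puts \<open>s\<close>, \<open>d\<close> and \<open>r\<close> under the
  hypotheses of \<open>sphere_dichotomy\<close>. Its first alternative contradicts \<open>avg_abs_lin_lower_bound\<close>,
  and \<open>near_extremal_weight\<close> handles the second.\<close>

lemma weight_ge_pair:
  assumes fin: "finite I" and pq: "p \<noteq> q" "p \<notin> I" "q \<notin> I"
    and ord: "w q \<le> w p" "0 \<le> w q" "\<And>i. i \<in> I \<Longrightarrow> 0 \<le> w i" "\<And>i. i \<in> I \<Longrightarrow> w i \<le> w q"
    and norm: "(\<Sum>i\<in>insert p (insert q I). (w i)\<^sup>2) = 1"
    and nz: "\<And>x. x \<in> signs (insert p (insert q I)) \<Longrightarrow> lin (insert p (insert q I)) w x \<noteq> 0"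
  shows "(7302 / 10000)\<^sup>2
    \<le> (\<Sum>i\<in>insert p (insert q I).
          (avg (insert p (insert q I)) (\<lambda>x. sgn (lin (insert p (insert q I)) w x) * x i))\<^sup>2)"
    (is "_ \<le> ?W")
proof -
  define J where "J = insert p (insert q I)"
  define s d r where "s = w p + w q" and "d = w p - w q" and "r = sqrt (\<Sum>i\<in>I. (w i)\<^sup>2)"
  have finJ: "finite J" using fin by (simp add: J_def)
  have r2: "r\<^sup>2 = (\<Sum>i\<in>I. (w i)\<^sup>2)" by (simp add: r_def sum_nonneg)
  have r0: "0 \<le> r" by (simp add: r_def sum_nonneg)
  have norm': "(w p)\<^sup>2 + (w q)\<^sup>2 + r\<^sup>2 = 1" using norm fin pq by (simp add: r2)
  have nn: "0 \<le> s" "0 \<le> d" "0 \<le> w p" using ord by (auto simp: s_def d_def)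
  show ?thesis
  proof (cases "7302 / 10000 \<le> avg J (\<lambda>x. \<bar>lin J w x\<bar>)")
    case True
    then have "(7302 / 10000)\<^sup>2 \<le> (avg J (\<lambda>x. \<bar>lin J w x\<bar>))\<^sup>2" by (intro power_mono) auto
    also have "\<dots> \<le> ?W"
      unfolding J_def by (rule sq_avg_abs_lin_le_weight[OF norm])
    finally show ?thesis .
  next
    case False
    have K: "(s + max d (69 / 100 * r)) / 2 \<le> avg J (\<lambda>x. \<bar>lin J w x\<bar>)"
      using avg_abs_lin_pair_ge[OF fin pq, of w] nn ord unfolding J_def s_def d_def r_def by simp
    have "s + d < 14604 / 10000" "s + 69 / 100 * r < 14604 / 10000"
      using K False by (auto simp: max_def split: if_splits)
    moreover have "s\<^sup>2 + d\<^sup>2 + 2 * r\<^sup>2 = 2"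
      using norm' by (simp add: s_def d_def power2_eq_square algebra_simps)
    ultimately consider "s \<le> 10404 / 10000" | "r\<^sup>2 \<le> 6 / 1000" "19 / 10 \<le> s\<^sup>2"
      using sphere_dichotomy[of s d r] nn r0 by blast
    then show ?thesis
    proof cases
      case 1
      have "(\<Sum>i\<in>I. w i ^ 4) \<le> (w q)\<^sup>2 * r\<^sup>2"
        unfolding r2 using ord by (intro fourth_powers_le) auto
      moreover have "(w q)\<^sup>2 * (1 - (w p)\<^sup>2) = w q ^ 4 + (w q)\<^sup>2 * r\<^sup>2"
      proof -
        have "1 - (w p)\<^sup>2 = (w q)\<^sup>2 + r\<^sup>2" using norm' by simp
        then show ?thesis by (simp add: distrib_left power4_eq_xxxx power2_eq_square)
      qed
      moreover have "w p ^ 4 + (w q)\<^sup>2 * (1 - (w p)\<^sup>2) \<le> 33 / 100"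
      proof (rule fourth_power_numeric)
        show "w p + w q \<le> 10404 / 10000" using 1 by (simp add: s_def)
        have "w p \<le> (s + max d (69 / 100 * r)) / 2" by (simp add: s_def d_def max_def)
        then show "w p \<le> 7302 / 10000" using K False by linarith
      qed (use ord in auto)
      ultimately have "(\<Sum>i\<in>J. w i ^ 4) \<le> 33 / 100"
        using fin pq by (simp add: J_def)
      then have "0.7968 * (1 - (33 / 100) / 4) \<le> avg J (\<lambda>x. \<bar>lin J w x\<bar>)"
        using norm by (intro avg_abs_lin_ge[OF finJ]) (auto simp: J_def)
      then show ?thesis using False by simp
    next
      case 2
      have "0 < s" using 2(2) nn by (cases "s = 0") auto
      have "r\<^sup>2 / s\<^sup>2 \<le> (6 / 1000) / (19 / 10)" using 2 by (intro frac_le) auto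
      then have "r\<^sup>2 / s\<^sup>2 \<le> 1 / 100" by simp
      then have "(99 / 100)\<^sup>2 \<le> (1 - r\<^sup>2 / s\<^sup>2)\<^sup>2" by (intro power_mono) auto
      moreover have "(7302 / 10000)\<^sup>2 \<le> (99 / 100)\<^sup>2 / 2 + (69 / 100)\<^sup>2 / (4 :: real)"
        by (simp add: power2_eq_square)
      ultimately have "(7302 / 10000)\<^sup>2 \<le> (1 - r\<^sup>2 / s\<^sup>2)\<^sup>2 / 2 + (69 / 100)\<^sup>2 / 4" by linarith
      also have "\<dots> \<le> ?W"
        unfolding r2 s_def
      proof (rule near_extremal_weight[OF fin pq _ nz])
        show "0 < w p + w q" using \<open>0 < s\<close> by (simp add: s_def)
        show "(\<Sum>i\<in>I. (w i)\<^sup>2) \<le> (w p + w q)\<^sup>2"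
          using 2 unfolding r2 s_def by linarith
      qed
      finally show ?thesis .
    qed
  qed
qed

lemma ex_max_on:
  fixes w :: "'i \<Rightarrow> real"
  assumes "finite J" "J \<noteq> {}"
  shows "\<exists>p\<in>J. \<forall>i\<in>J. w i \<le> w p"
proof -
  have "Max (w ` J) \<in> w ` J" using assms by (intro Max_in) auto
  then obtain p where "p \<in> J" "w p = Max (w ` J)" by auto
  moreover have "w i \<le> Max (w ` J)" if "i \<in> J" for i using that assms by (intro Max_ge) auto
  ultimately show ?thesis by force
qed

lemma weight_ge_nonneg:
  assumes fin: "finite J" and card: "2 \<le> card J" and nonneg: "\<And>i. i \<in> J \<Longrightarrow> 0 \<le> w i"
    and nz: "\<And>x. x \<in> signs J \<Longrightarrow> lin J w x \<noteq> 0"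
  shows "(7302 / 10000)\<^sup>2 \<le> (\<Sum>i\<in>J. (avg J (\<lambda>x. sgn (lin J w x) * x i))\<^sup>2)"
proof -
  define r where "r = sqrt (\<Sum>i\<in>J. (w i)\<^sup>2)"
  have r2: "r\<^sup>2 = (\<Sum>i\<in>J. (w i)\<^sup>2)" by (simp add: r_def sum_nonneg)
  have r: "0 < r"
  proof (rule ccontr)
    assume "\<not> 0 < r"
    moreover have "0 \<le> r" by (simp add: r_def sum_nonneg)
    ultimately have "(\<Sum>i\<in>J. (w i)\<^sup>2) = 0" using r2 by simp
    then have "w i = 0" if "i \<in> J" for i using that fin by (simp add: sum_nonneg_eq_0_iff)
    then have "lin J w (\<lambda>i\<in>J. 1) = 0" by (simp add: lin_def)
    moreover have "(\<lambda>i\<in>J. 1) \<in> signs J" unfolding signs_def by auto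
    ultimately show False using nz by blast
  qed
  define u where "u i = w i / r" for i
  have u: "lin J u x = lin J w x / r" for x
    using lin_scale[of J w r x] by (simp add: u_def[abs_def])
  have sg: "sgn (lin J u x) = sgn (lin J w x)" for x
    using r by (simp add: u sgn_divide)
  have "J \<noteq> {}" using card by auto
  then obtain p where p: "p \<in> J" "\<forall>i\<in>J. w i \<le> w p" using ex_max_on[OF fin] by blast
  have "J - {p} \<noteq> {}" using card p fin by (metis card_Diff_singleton card.empty One_nat_def Suc_1
      diff_is_0_eq not_less_eq_eq order_refl)
  then obtain q where q: "q \<in> J - {p}" "\<forall>i\<in>J - {p}. w i \<le> w q" using ex_max_on[of "J - {p}" w] fin by blast
  define I where "I = J - {p, q}"
  have J: "J = insert p (insert q I)" using p q by (auto simp: I_def)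
  have "(7302 / 10000)\<^sup>2 \<le> (\<Sum>i\<in>J. (avg J (\<lambda>x. sgn (lin J u x) * x i))\<^sup>2)"
    unfolding J
  proof (rule weight_ge_pair)
    show "(\<Sum>i\<in>insert p (insert q I). (u i)\<^sup>2) = 1"
      unfolding J[symmetric] u_def power_divide sum_divide_distrib[symmetric] r2[symmetric] using r by simp
    show "lin (insert p (insert q I)) u x \<noteq> 0" if "x \<in> signs (insert p (insert q I))" for x
      using nz[of x] that r unfolding J[symmetric] u by simp
  qed (use p q r nonneg fin in \<open>auto simp: I_def u_def divide_right_mono\<close>)
  then show ?thesis unfolding sg .
qed

text \<open>Flipping the coordinates with negative weight changes the coefficients only in sign.\<close>

theorem weight_ge:
  assumes fin: "finite J" and card: "2 \<le> card J"
    and nz: "\<And>x. x \<in> signs J \<Longrightarrow> lin J w x \<noteq> 0"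
  shows "(7302 / 10000)\<^sup>2 \<le> (\<Sum>i\<in>J. (avg J (\<lambda>x. sgn (lin J w x) * x i))\<^sup>2)"
proof -
  define e :: "'a \<Rightarrow> real" where "e i = (if w i < 0 then -1 else 1)" for i
  have e: "e \<in> J \<rightarrow> {-1, 1}" by (auto simp: e_def)
  have abs: "\<bar>w i\<bar> = e i * w i" for i by (simp add: e_def)
  have lin: "lin J (\<lambda>i. \<bar>w i\<bar>) x = lin J w (flip J e x)" for x
    by (simp add: lin_flip abs)
  have "(avg J (\<lambda>x. sgn (lin J (\<lambda>i. \<bar>w i\<bar>) x) * x i))\<^sup>2 = (avg J (\<lambda>x. sgn (lin J w x) * x i))\<^sup>2"
    if "i \<in> J" for i
  proof -
    have "avg J (\<lambda>x. sgn (lin J (\<lambda>i. \<bar>w i\<bar>) x) * x i)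
      = avg J (\<lambda>x. (\<lambda>y. e i * (sgn (lin J w y) * y i)) (flip J e x))"
      using that by (intro avg_cong) (auto simp: lin flip_def e_def)
    also have "\<dots> = avg J (\<lambda>y. e i * (sgn (lin J w y) * y i))" by (rule avg_flip[OF e])
    also have "\<dots> = e i * avg J (\<lambda>x. sgn (lin J w x) * x i)" by (rule avg_cmult)
    finally show ?thesis by (simp add: e_def)
  qed
  then show ?thesis
    using weight_ge_nonneg[OF fin card, of "\<lambda>i. \<bar>w i\<bar>"] nz flip_signs[OF e] by (simp add: lin)
qed

section \<open>From threshold functions to homogeneous linear forms\<close>

lemma cube_eq_signs: "cube n = signs {1..n}"
  unfolding cube_def signs_def ..

lemma expect_eq_avg: "expect n g = avg {1..n} g"
proof -
  have "finite (cube n)" "cube n \<noteq> {}"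
    unfolding cube_def by (auto intro!: finite_PiE simp: PiE_eq_empty_iff)
  then show ?thesis
    unfolding expect_def avg_def by (simp add: integral_pmf_of_set cube_eq_signs card_signs)
qed

lemma weight_le1_eq:
  "weight_le1 n f = (avg {1..n} f)\<^sup>2 + (\<Sum>i\<in>{1..n}. (avg {1..n} (\<lambda>x. f x * x i))\<^sup>2)"
proof -
  have sets: "{S. S \<subseteq> {1..n} \<and> card S \<le> 1} = insert {} ((\<lambda>i. {i}) ` {1..n})"
  proof (intro equalityI subsetI)
    fix S assume S: "S \<in> {S. S \<subseteq> {1..n} \<and> card S \<le> 1}"
    then have "finite S" using finite_subset by blast
    then have "S = {} \<or> (\<exists>i. S = {i})" using S by (cases "card S") (auto simp: card_1_singleton_iff)
    then show "S \<in> insert {} ((\<lambda>i. {i}) ` {1..n})" using S by auto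
  qed auto
  show ?thesis
    unfolding weight_le1_def sets fourier_coeff_def expect_eq_avg
    by (subst sum.insert) (auto simp: sum.reindex)
qed

text \<open>A small increase of the threshold makes the convention \<open>sign_pm 0 = 1\<close> harmless: values \<open>0\<close>
  become positive, and no negative value reaches \<open>0\<close>.\<close>

lemma threshold_without_ties:
  fixes L :: "'a \<Rightarrow> real"
  assumes "finite X"
  shows "\<exists>c. \<forall>x\<in>X. c + L x \<noteq> 0 \<and> sign_pm (b + L x) = sgn (c + L x)"
proof -
  define V where "V = (\<lambda>x. - (b + L x)) ` {x \<in> X. b + L x < 0}"
  define m where "m = Min (insert 1 V)"
  have finV: "finite V" using assms by (simp add: V_def)
  have "0 < m" unfolding m_def using finV by (auto simp: V_def)
  have m: "m \<le> - (b + L x)" if "x \<in> X" "b + L x < 0" for x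
    unfolding m_def using finV that by (intro Min_le) (auto simp: V_def)
  show ?thesis
  proof (intro exI[of _ "b + m / 2"] ballI)
    fix x assume "x \<in> X"
    then show "b + m / 2 + L x \<noteq> 0 \<and> sign_pm (b + L x) = sgn (b + m / 2 + L x)"
      using m[of x] \<open>0 < m\<close> by (cases "b + L x < 0") (auto simp: sign_pm_def sgn_real_def)
  qed
qed

text \<open>The constant term of the threshold function becomes the weight of a new coordinate \<open>0\<close>. The
  resulting sign function is odd, so averaging over \<open>x 0\<close> returns the original coefficients, with
  the coefficient at \<open>0\<close> in the place of the mean.\<close>

theorem LTF_weight_ge:
  assumes n: "1 \<le> n" and ltf: "is_LTF n f"
  shows "(7302 / 10000)\<^sup>2 \<le> weight_le1 n f"
proof -
  define I where "I = {1..n}"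
  have I: "finite I" "0 \<notin> I" by (auto simp: I_def)
  obtain v where v: "\<And>x. x \<in> signs I \<Longrightarrow> f x = sign_pm (v 0 + lin I v x)"
    using ltf unfolding is_LTF_def cube_eq_signs lin_def I_def by blast
  obtain c where c: "\<And>x. x \<in> signs I \<Longrightarrow> c + lin I v x \<noteq> 0"
      "\<And>x. x \<in> signs I \<Longrightarrow> sign_pm (v 0 + lin I v x) = sgn (c + lin I v x)"
    using threshold_without_ties[OF finite_signs[OF I(1)], of "lin I v" "v 0"] by blast
  define w where "w = v(0 := c)"
  have w0: "w 0 = c" by (simp add: w_def)
  have linw: "lin I w x = lin I v x" for x
    unfolding lin_def w_def using I(2) by (intro sum.cong) auto
  have f: "f x = sgn (w 0 + lin I w x)" if "x \<in> signs I" for x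
    using v[OF that] c(2)[OF that] by (simp add: w0 linw)
  define m :: "nat \<Rightarrow> real" where "m = (\<lambda>_. -1)"
  have m: "m \<in> I \<rightarrow> {-1, 1}" by (simp add: m_def)
  have neg: "lin I w (flip I m x) = - lin I w x" for x
    unfolding lin_flip by (simp add: m_def lin_def sum_negf)
  let ?J = "insert 0 I"
  have linJ: "lin ?J w (x(0 := e)) = e * w 0 + lin I w x" for x e
    using lin_insert_upd[OF I] .
  have coeff0: "avg ?J (\<lambda>x. sgn (lin ?J w x) * x 0) = avg I f"
  proof -
    have "avg I (\<lambda>x. - sgn (- w 0 + lin I w x)) = avg I (\<lambda>x. (\<lambda>y. sgn (w 0 + lin I w y)) (flip I m x))"
      unfolding neg by (intro avg_cong) (simp flip: sgn_minus)
    also have "\<dots> = avg I (\<lambda>x. sgn (w 0 + lin I w x))" by (rule avg_flip[OF m])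
    finally have "avg ?J (\<lambda>x. sgn (lin ?J w x) * x 0) = avg I (\<lambda>x. sgn (w 0 + lin I w x))"
      unfolding avg_insert[OF I] linJ by simp
    also have "\<dots> = avg I f" by (rule avg_cong) (simp add: f)
    finally show ?thesis .
  qed
  have coeff: "avg ?J (\<lambda>x. sgn (lin ?J w x) * x i) = avg I (\<lambda>x. f x * x i)" if "i \<in> I" for i
  proof -
    have i: "i \<noteq> 0" using that I by metis
    have "avg I (\<lambda>x. sgn (- w 0 + lin I w x) * x i) = avg I (\<lambda>x. (\<lambda>y. sgn (w 0 + lin I w y) * y i) (flip I m x))"
    proof (rule avg_cong)
      fix x
      have "sgn (- w 0 + lin I w x) = - sgn (w 0 - lin I w x)" by (simp flip: sgn_minus)
      then show "sgn (- w 0 + lin I w x) * x i = sgn (w 0 + lin I w (flip I m x)) * flip I m x i"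
        using that unfolding neg by (simp add: flip_def m_def)
    qed
    also have "\<dots> = avg I (\<lambda>x. sgn (w 0 + lin I w x) * x i)" by (rule avg_flip[OF m])
    finally have "avg ?J (\<lambda>x. sgn (lin ?J w x) * x i) = avg I (\<lambda>x. sgn (w 0 + lin I w x) * x i)"
      unfolding avg_insert[OF I] linJ using i by simp
    also have "\<dots> = avg I (\<lambda>x. f x * x i)" by (rule avg_cong) (simp add: f)
    finally show ?thesis .
  qed
  have nz: "lin ?J w x \<noteq> 0" if "x \<in> signs ?J" for x
  proof -
    define y where "y = restrict x I"
    have y: "y \<in> signs I" using that unfolding y_def signs_def by (auto simp: PiE_iff)
    have "lin I w x = lin I w y" unfolding lin_def y_def by (intro sum.cong) auto
    then have e: "lin ?J w x = x 0 * w 0 + lin I w y" using I by (simp add: lin_def)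
    have "w 0 + lin I w y \<noteq> 0" "w 0 - lin I w y \<noteq> 0"
      using c(1)[OF y] c(1)[OF flip_signs[OF m y]] neg[of y] by (auto simp: w0 linw)
    then show ?thesis using signs_nth[OF that, of 0] e by auto
  qed
  have "(7302 / 10000)\<^sup>2 \<le> (\<Sum>i\<in>?J. (avg ?J (\<lambda>x. sgn (lin ?J w x) * x i))\<^sup>2)"
    by (rule weight_ge) (use I n nz in \<open>auto simp: I_def\<close>)
  also have "\<dots> = weight_le1 n f"
    using I coeff0 coeff by (simp add: weight_le1_eq I_def)
  finally show ?thesis .
qed

theorem theorem4:
  shows "W_le1_LTF \<ge> (1 / sqrt 2 + 277 / 12000)\<^sup>2
    \<and> (1 / sqrt 2 + 277 / 12000)\<^sup>2 > (0.53317 :: real)"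
proof
  have "(7302 / 10000)\<^sup>2 \<le> W_le1_LTF"
    unfolding W_le1_LTF_def
    by (rule cInf_greatest[OF LTF_weights_nonempty]) (use LTF_weight_ge in \<open>auto simp only: LTF_weights_def\<close>)
  then show "W_le1_LTF \<ge> (1 / sqrt 2 + 277 / 12000)\<^sup>2"
    using target_bounds(2) by linarith
qed (rule target_bounds(1))

end
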